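(* For every positive integer $n$ and every prime $p$, there exists a special $p$-group $G$ such that the lattice $\mathcal{CD}(G)$ is isomorphic to $\mathcal{L}(E_{p^n})$.
   Context: For a finite group $G$ and a subgroup $H\le G$, the Chermak-Delgado measure of $H$ in $G$ is $m_G(H)=|H|\cdot|C_G(H)|$. Put $m^*(G)=\max\{m_G(H)\mid H\le G\}$ and $\mathcal{CD}(G)=\{H\le G\mid m_G(H)=m^*(G)\}$. The set $\mathcal{CD}(G)$ is a sublattice of the subgroup lattice of $G$ (ordered by inclusion), called the Chermak-Delgado lattice of $G$. $\mathcal{L}(X)$ denotes the subgroup lattice of a group $X$, and $E_{p^n}$ denotes the elementary abelian $p$-group of order $p^n$. A special $p$-group is a finite non-abelian $p$-group $G$ with $\Phi(G)=Z(G)=G'$ (elementary abelian). *)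

theory Defs
  imports "HOL-Algebra.Algebra" "HOL-Computational_Algebra.Primes"
begin

definition centralizer :: "('a, 'b) monoid_scheme \<Rightarrow> 'a set \<Rightarrow> 'a set" where
  "centralizer G A = {g \<in> carrier G. \<forall>a\<in>A. g \<otimes>\<^bsub>G\<^esub> a = a \<otimes>\<^bsub>G\<^esub> g}"

definition group_center :: "('a, 'b) monoid_scheme \<Rightarrow> 'a set" where
  "group_center G = centralizer G (carrier G)"

definition maximal_subgroup :: "'a set \<Rightarrow> ('a, 'b) monoid_scheme \<Rightarrow> bool" where
  "maximal_subgroup M G \<longleftrightarrow>
     subgroup M G \<and> M \<noteq> carrier G \<and>
     (\<forall>H. subgroup H G \<longrightarrow> M \<subseteq> H \<longrightarrow> H = M \<or> H = carrier G)"

text \<open>Intersecting with the carrier makes the subgroup equal to the whole group when there are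
  no maximal subgroups.\<close>

definition frattini_subgroup :: "('a, 'b) monoid_scheme \<Rightarrow> 'a set" where
  "frattini_subgroup G = carrier G \<inter> \<Inter>{M. maximal_subgroup M G}"

definition finite_p_group :: "nat \<Rightarrow> ('a, 'b) monoid_scheme \<Rightarrow> bool" where
  "finite_p_group p G \<longleftrightarrow>
     Factorial_Ring.prime p \<and> group G \<and> finite (carrier G) \<and> (\<exists>k. order G = p ^ k)"

definition elementary_abelian :: "nat \<Rightarrow> ('a, 'b) monoid_scheme \<Rightarrow> bool" where
  "elementary_abelian p A \<longleftrightarrow>
     Factorial_Ring.prime p \<and> comm_group A \<and> (\<forall>x\<in>carrier A. x [^]\<^bsub>A\<^esub> p = \<one>\<^bsub>A\<^esub>)"

definition special_p_group :: "nat \<Rightarrow> ('a, 'b) monoid_scheme \<Rightarrow> bool" where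
  "special_p_group p G \<longleftrightarrow>
     finite_p_group p G \<and> \<not> comm_group G \<and>
     frattini_subgroup G = group_center G \<and>
     group_center G = derived G (carrier G) \<and>
     elementary_abelian p (G\<lparr>carrier := group_center G\<rparr>)"

definition cd_measure :: "('a, 'b) monoid_scheme \<Rightarrow> 'a set \<Rightarrow> nat" where
  "cd_measure G H = card H * card (centralizer G H)"

definition max_cd_measure :: "('a, 'b) monoid_scheme \<Rightarrow> nat" where
  "max_cd_measure G = Max {cd_measure G H | H. subgroup H G}"

definition CD :: "('a, 'b) monoid_scheme \<Rightarrow> 'a set set" where
  "CD G = {H. subgroup H G \<and> cd_measure G H = max_cd_measure G}"

text \<open>For a finite group, \<^const>\<open>CD\<close> is a sublattice of the subgroup lattice, so the joins and
  meets determined by inclusion on it agree with those of the subgroup lattice.\<close>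

definition CD_lattice :: "('a, 'b) monoid_scheme \<Rightarrow> 'a set gorder" where
  "CD_lattice G = \<lparr>carrier = CD G, eq = (=), le = (\<subseteq>)\<rparr>"

definition subgroup_lattice :: "('a, 'b) monoid_scheme \<Rightarrow> 'a set gorder" where
  "subgroup_lattice G = \<lparr>carrier = {H. subgroup H G}, eq = (=), le = (\<subseteq>)\<rparr>"

text \<open>That both sides are lattices is part of \<^const>\<open>join_pres\<close> and \<^const>\<open>meet_pres\<close>.\<close>

definition lattice_isomorphic :: "('a, 'c) gorder_scheme \<Rightarrow> ('b, 'd) gorder_scheme \<Rightarrow> bool" where
  "lattice_isomorphic L M \<longleftrightarrow>
     (\<exists>f. bij_betw f (carrier L) (carrier M) \<and> join_pres L M f \<and> meet_pres L M f)"

text \<open>The elementary abelian group of order \<open>p ^ n\<close>, realised as the direct product of \<open>n\<close>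
  copies of the integers modulo \<open>p\<close>.\<close>

definition elementary_abelian_power :: "nat \<Rightarrow> nat \<Rightarrow> (nat \<Rightarrow> int) monoid" where
  "elementary_abelian_power p n = product_group {..<n} (\<lambda>_. integer_mod_group p)"

lemma order_elementary_abelian_power:
  assumes "Factorial_Ring.prime p"
  shows "order (elementary_abelian_power p n) = p ^ n"
proof -
  have "p \<noteq> 0" using assms by auto
  then show ?thesis
    by (simp add: order_def elementary_abelian_power_def card_PiE carrier_integer_mod_group)
qed

lemma elementary_abelian_elementary_abelian_power:
  assumes "Factorial_Ring.prime p"
  shows "elementary_abelian p (elementary_abelian_power p n)"
proof -
  let ?E = "elementary_abelian_power p n"
  have group: "group ?E"
    by (simp add: elementary_abelian_power_def)
  have comm: "comm_group ?E"
    by (rule group.group_comm_groupI[OF group])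
      (auto simp: elementary_abelian_power_def add.commute intro!: restrict_ext)
  have pow: "x [^]\<^bsub>?E\<^esub> m = (\<lambda>i\<in>{..<n}. (int m * x i) mod int p)" for x and m :: nat
    by (induction m)
      (auto simp: elementary_abelian_power_def distrib_right add.commute mod_add_right_eq
        intro!: restrict_ext)
  show ?thesis
    using assms comm unfolding elementary_abelian_def pow
    by (auto simp: elementary_abelian_power_def)
qed

end

theory Submission
  imports Defs "HOL-Analysis.Complex_Transcendental" "HOL-Number_Theory.Cong"
begin

text \<open>
  Let \<open>V\<close> be the space of \<open>n \<times> 4\<close> matrices over the field with \<open>p\<close> elements, written as quadruples of
  columns. The group is the central extension of \<open>V\<close> by \<open>6\<close> coordinates in which \<open>u\<close> and \<open>v\<close>
  have commutator \<open>u\<^sub>i \<cdot> v\<^sub>j - u\<^sub>j \<cdot> v\<^sub>i\<close> for \<open>i < j\<close>. The sum of the coordinates \<open>(0, 1)\<close> and \<open>(2, 3)\<close> is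
  a nondegenerate form, so the commutant \<open>P\<close> of a subspace \<open>U\<close> satisfies \<open>|U| |P| \<le> |V|\<close>, with
  equality only if \<open>P\<close> is already the orthogonal complement of \<open>U\<close> for that single form. In that
  case the other coordinates force all products \<open>u\<^sub>i \<cdot> v\<^sub>j\<close> with \<open>u \<in> U\<close>, \<open>v \<in> P\<close> to vanish, and hence
  \<open>U = S\<^sup>4\<close> for a subspace \<open>S\<close> of the column space. Conversely every \<open>S\<^sup>4\<close> attains equality, its
  commutant being the fourth power of the orthogonal complement of \<open>S\<close>. So the Chermak-Delgado lattice
  consists of the preimages of the subspaces \<open>S\<^sup>4\<close>.
\<close>

section \<open>Order isomorphisms and lattices\<close>

text \<open>An order isomorphism carries sets of bounds to sets of bounds, so extremal bounds
  correspond in both directions.\<close>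

lemma least_Upper_order_iso:
  assumes f: "bij_betw f (carrier L) (carrier M)"
    and le: "\<And>x y. x \<in> carrier L \<Longrightarrow> y \<in> carrier L \<Longrightarrow> f x \<sqsubseteq>\<^bsub>M\<^esub> f y \<longleftrightarrow> x \<sqsubseteq>\<^bsub>L\<^esub> y"
    and A: "A \<subseteq> carrier L" and x: "x \<in> carrier L"
  shows "least M (f x) (Upper M (f ` A)) \<longleftrightarrow> least L x (Upper L A)"
    and "greatest M (f x) (Lower M (f ` A)) \<longleftrightarrow> greatest L x (Lower L A)"
proof -
  have M: "carrier M = f ` carrier L"
    using f by (simp add: bij_betw_def)
  have up: "Upper M (f ` A) = f ` Upper L A" and low: "Lower M (f ` A) = f ` Lower L A"
    using A le unfolding Upper_def Lower_def M by blast+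
  have sub: "Upper L A \<subseteq> carrier L" "Lower L A \<subseteq> carrier L"
    by auto
  have mem: "f x \<in> f ` B \<longleftrightarrow> x \<in> B" if "B \<subseteq> carrier L" for B
    using inj_on_image_mem_iff[OF bij_betw_imp_inj_on[OF f] x that] .
  have img: "f ` B \<subseteq> carrier M" if "B \<subseteq> carrier L" for B
    using that M by blast
  show "least M (f x) (Upper M (f ` A)) \<longleftrightarrow> least L x (Upper L A)"
    unfolding up least_def using sub le x mem[OF sub(1)] img[OF sub(1)] by (auto simp: subset_iff)
  show "greatest M (f x) (Lower M (f ` A)) \<longleftrightarrow> greatest L x (Lower L A)"
    unfolding low greatest_def using sub le x mem[OF sub(2)] img[OF sub(2)] by (auto simp: subset_iff)
qed

text \<open>Only \<open>M\<close> is assumed to be a lattice; bounds are pulled back along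
  \<open>f\<close>. This is how the existence of joins and meets in \<open>CD_lattice G\<close> is
  obtained.\<close>

lemma order_iso_imp_lattice_isomorphic:
  assumes M: "lattice M" and po: "partial_order L"
    and f: "bij_betw f (carrier L) (carrier M)"
    and le: "\<And>x y. x \<in> carrier L \<Longrightarrow> y \<in> carrier L \<Longrightarrow> f x \<sqsubseteq>\<^bsub>M\<^esub> f y \<longleftrightarrow> x \<sqsubseteq>\<^bsub>L\<^esub> y"
  shows "lattice_isomorphic L M"
proof -
  interpret M: lattice M by (rule M)
  interpret L: partial_order L by (rule po)
  have fc: "f x \<in> carrier M" if "x \<in> carrier L" for x
    using f that by (auto simp: bij_betw_def)
  have surj: "\<exists>x\<in>carrier L. f x = y" if "y \<in> carrier M" for y
    using f that unfolding bij_betw_def by (metis imageE)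
  have lub: "least M (f s) (Upper M {f x, f y}) \<longleftrightarrow> least L s (Upper L {x, y})"
    and glb: "greatest M (f s) (Lower M {f x, f y}) \<longleftrightarrow> greatest L s (Lower L {x, y})"
    if "x \<in> carrier L" "y \<in> carrier L" "s \<in> carrier L" for x y s
    using least_Upper_order_iso[OF f le, of "{x, y}" s] that by simp_all
  have "\<exists>s. least L s (Upper L {x, y})" if "x \<in> carrier L" "y \<in> carrier L" for x y
  proof -
    obtain s where s: "least M s (Upper M {f x, f y})"
      using M.sup_of_two_exists[OF fc fc] \<open>x \<in> carrier L\<close> \<open>y \<in> carrier L\<close> by blast
    then obtain t where "t \<in> carrier L" "s = f t"
      using surj least_closed[OF s] by auto
    then show ?thesis using s lub that by blast
  qed
  moreover have "\<exists>s. greatest L s (Lower L {x, y})" if "x \<in> carrier L" "y \<in> carrier L" for x y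
  proof -
    obtain s where s: "greatest M s (Lower M {f x, f y})"
      using M.inf_of_two_exists[OF fc fc] \<open>x \<in> carrier L\<close> \<open>y \<in> carrier L\<close> by blast
    then obtain t where "t \<in> carrier L" "s = f t"
      using surj greatest_closed[OF s] by auto
    then show ?thesis using s glb that by blast
  qed
  ultimately interpret L: lattice L
    by unfold_locales auto
  have "f (x \<squnion>\<^bsub>L\<^esub> y) = f x \<squnion>\<^bsub>M\<^esub> f y" if xy: "x \<in> carrier L" "y \<in> carrier L" for x y
  proof -
    have "least L (x \<squnion>\<^bsub>L\<^esub> y) (Upper L {x, y})"
      unfolding join_def using L.sup_of_two_least[OF xy] .
    then have "least M (f (x \<squnion>\<^bsub>L\<^esub> y)) (Upper M {f x, f y})"
      using lub[OF xy] L.join_closed[OF xy] by blast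
    moreover have "least M (f x \<squnion>\<^bsub>M\<^esub> f y) (Upper M {f x, f y})"
      unfolding join_def using M.sup_of_two_least[OF fc fc] xy by blast
    ultimately show ?thesis by (rule M.least_unique)
  qed
  moreover have "f (x \<sqinter>\<^bsub>L\<^esub> y) = f x \<sqinter>\<^bsub>M\<^esub> f y" if xy: "x \<in> carrier L" "y \<in> carrier L" for x y
  proof -
    have "greatest L (x \<sqinter>\<^bsub>L\<^esub> y) (Lower L {x, y})"
      unfolding meet_def using L.inf_of_two_greatest[OF xy] .
    then have "greatest M (f (x \<sqinter>\<^bsub>L\<^esub> y)) (Lower M {f x, f y})"
      using glb[OF xy] L.meet_closed[OF xy] by blast
    moreover have "greatest M (f x \<sqinter>\<^bsub>M\<^esub> f y) (Lower M {f x, f y})"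
      unfolding meet_def using M.inf_of_two_greatest[OF fc fc] xy by blast
    ultimately show ?thesis by (rule M.greatest_unique)
  qed
  ultimately show ?thesis
    unfolding lattice_isomorphic_def join_pres_def meet_pres_def
    using f L.lattice_axioms M.lattice_axioms by blast
qed

section \<open>Annihilators under pairings of finite groups\<close>

text \<open>Roots of unity serve as additive characters of the integers modulo \<open>p\<close>, so
  that orthogonality becomes a statement about complex sums.\<close>

lemma cis_residue_eq_1_iff:
  assumes "p > 0"
  shows "cis (2 * pi * of_int a / real p) = 1 \<longleftrightarrow> int p dvd a"
proof -
  have "cis (2 * pi * of_int a / real p) = 1 \<longleftrightarrow> (\<exists>m::int. of_int a = real p * of_int m)"
    using assms unfolding cis_conv_exp exp_eq_1 by (auto simp: field_simps)
  also have "\<dots> \<longleftrightarrow> (\<exists>m. a = int p * m)"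
    by (metis of_int_eq_iff of_int_mult of_int_of_nat_eq)
  finally show ?thesis by (auto simp: dvd_def)
qed

lemma cis_residue_cong:
  assumes "p > 0" "[a = b] (mod int p)"
  shows "cis (2 * pi * of_int a / real p) = cis (2 * pi * of_int b / real p)"
proof -
  have "cis (2 * pi * of_int (a - b) / real p) = 1"
    using assms by (simp only: cis_residue_eq_1_iff cong_iff_dvd_diff)
  moreover have "cis (2 * pi * of_int a / real p) =
      cis (2 * pi * of_int (a - b) / real p) * cis (2 * pi * of_int b / real p)"
    by (simp add: cis_mult diff_divide_distrib right_diff_distrib)
  ultimately show ?thesis by simp
qed

text \<open>Substituting \<open>y \<otimes> x\<close> for \<open>x\<close> multiplies the sum by the
  root of unity attached to \<open>h y\<close>. If some \<open>h y\<close> is not divisible by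
  \<open>p\<close>, that factor differs from 1 and the sum must vanish.\<close>

lemma (in group) sum_residue_character:
  assumes p: "p > 0"
    and h: "\<And>x y. x \<in> carrier G \<Longrightarrow> y \<in> carrier G \<Longrightarrow> [h (x \<otimes> y) = h x + h y] (mod int p)"
  shows "(\<Sum>x\<in>carrier G. cis (2 * pi * of_int (h x) / real p)) =
    (if \<forall>x\<in>carrier G. int p dvd h x then of_nat (card (carrier G)) else 0)"
proof (cases "\<forall>x\<in>carrier G. int p dvd h x")
  case True
  then have "(\<Sum>x\<in>carrier G. cis (2 * pi * of_int (h x) / real p)) = (\<Sum>x\<in>carrier G. 1)"
    using cis_residue_eq_1_iff[OF p] by (intro sum.cong) auto
  then show ?thesis using True by simp
next
  case False
  then obtain y where y: "y \<in> carrier G" "\<not> int p dvd h y" by blast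
  let ?S = "\<Sum>x\<in>carrier G. cis (2 * pi * of_int (h x) / real p)"
  have "?S = (\<Sum>x\<in>carrier G. cis (2 * pi * of_int (h (y \<otimes> x)) / real p))"
    by (rule sum.reindex_bij_betw[symmetric]) (use y in \<open>auto simp: bij_betw_def inj_on_cmult surj_const_mult\<close>)
  also have "\<dots> = (\<Sum>x\<in>carrier G. cis (2 * pi * of_int (h y) / real p) * cis (2 * pi * of_int (h x) / real p))"
  proof (rule sum.cong)
    fix x assume "x \<in> carrier G"
    then have "cis (2 * pi * of_int (h (y \<otimes> x)) / real p) = cis (2 * pi * of_int (h y + h x) / real p)"
      using h y by (intro cis_residue_cong p) auto
    then show "cis (2 * pi * of_int (h (y \<otimes> x)) / real p) =
      cis (2 * pi * of_int (h y) / real p) * cis (2 * pi * of_int (h x) / real p)"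
      by (simp add: cis_mult algebra_simps add_divide_distrib)
  qed simp
  also have "\<dots> = cis (2 * pi * of_int (h y) / real p) * ?S"
    by (simp add: sum_distrib_left)
  finally have "?S = 0"
    using cis_residue_eq_1_iff[OF p, of "h y"] y by auto
  then show ?thesis using False by auto
qed

text \<open>Both ways of summing the characters \<open>e(f u b)\<close> over \<open>U \<times> B\<close> are evaluated by
  orthogonality.\<close>

lemma card_subgroup_annihilator:
  fixes A :: "('a, 'c) monoid_scheme" and B :: "('b, 'd) monoid_scheme" and p :: nat
    and f :: "'a \<Rightarrow> 'b \<Rightarrow> int"
  assumes A: "group A" and B: "group B" and p: "p > 0" and U: "subgroup U A"
    and addA: "\<And>x y b. x \<in> carrier A \<Longrightarrow> y \<in> carrier A \<Longrightarrow> b \<in> carrier B \<Longrightarrow>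
        [f (x \<otimes>\<^bsub>A\<^esub> y) b = f x b + f y b] (mod int p)"
    and addB: "\<And>a x y. a \<in> carrier A \<Longrightarrow> x \<in> carrier B \<Longrightarrow> y \<in> carrier B \<Longrightarrow>
        [f a (x \<otimes>\<^bsub>B\<^esub> y) = f a x + f a y] (mod int p)"
    and nondegenerate: "\<And>a. a \<in> carrier A \<Longrightarrow> \<forall>b\<in>carrier B. int p dvd f a b \<Longrightarrow> a = \<one>\<^bsub>A\<^esub>"
    and finA: "finite (carrier A)" and finB: "finite (carrier B)"
  shows "card U * card {b \<in> carrier B. \<forall>u\<in>U. int p dvd f u b} = card (carrier B)"
proof -
  interpret A: group A by (rule A)
  interpret B: group B by (rule B)
  let ?c = "\<lambda>a b. cis (2 * pi * of_int (f a b) / real p)"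
  let ?ann = "{b \<in> carrier B. \<forall>u\<in>U. int p dvd f u b}"
  have UA: "U \<subseteq> carrier A" using U by (rule subgroup.subset)
  have finU: "finite U" using UA finA by (rule finite_subset)
  have one: "int p dvd f \<one>\<^bsub>A\<^esub> b" if "b \<in> carrier B" for b
    using addA[of "\<one>\<^bsub>A\<^esub>" "\<one>\<^bsub>A\<^esub>" b] that by (simp add: cong_iff_dvd_diff)
  have "(\<Sum>b\<in>carrier B. \<Sum>u\<in>U. ?c u b) =
      (\<Sum>b\<in>carrier B. if \<forall>u\<in>U. int p dvd f u b then of_nat (card U) else 0)"
  proof (rule sum.cong)
    fix b assume "b \<in> carrier B"
    then show "(\<Sum>u\<in>U. ?c u b) = (if \<forall>u\<in>U. int p dvd f u b then of_nat (card U) else 0)"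
      using group.sum_residue_character[OF A.subgroup_imp_group[OF U] p, of "\<lambda>u. f u b"] addA UA
      by (simp add: subset_iff)
  qed simp
  also have "\<dots> = of_nat (card U * card ?ann)"
    using finB by (simp add: sum.If_cases Int_def)
  finally have 1: "(\<Sum>b\<in>carrier B. \<Sum>u\<in>U. ?c u b) = of_nat (card U * card ?ann)" .
  \<comment> \<open>Nondegeneracy leaves only \<open>u = \<one>\<close> with a nonzero inner sum, so
    this order of summation counts \<open>B\<close> once.\<close>
  have "(\<Sum>u\<in>U. \<Sum>b\<in>carrier B. ?c u b) = (\<Sum>u\<in>U. if u = \<one>\<^bsub>A\<^esub> then of_nat (card (carrier B)) else 0)"
  proof (rule sum.cong)
    fix u assume "u \<in> U"
    then show "(\<Sum>b\<in>carrier B. ?c u b) = (if u = \<one>\<^bsub>A\<^esub> then of_nat (card (carrier B)) else 0)"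
      using B.sum_residue_character[OF p, of "f u"] addB UA nondegenerate one
      by (auto simp: subset_iff)
  qed simp
  also have "\<dots> = of_nat (card (carrier B))"
    using finU subgroup.one_closed[OF U] by simp
  finally show ?thesis
    using 1 sum.swap[of ?c "carrier B" U] by (metis (no_types, lifting) of_nat_eq_iff)
qed

section \<open>Quadruples of columns\<close>

text \<open>The sum is taken over the integers without reduction, so every linearity statement about
  it is a congruence modulo \<open>p\<close>.\<close>

definition dot :: "nat \<Rightarrow> (nat \<Rightarrow> int) \<Rightarrow> (nat \<Rightarrow> int) \<Rightarrow> int" where
  "dot n u v = (\<Sum>k<n. u k * v k)"

lemma dot_commute: "dot n u v = dot n v u"
  by (simp add: dot_def mult.commute)

lemma dot_mult_left:
  "[dot n (u \<otimes>\<^bsub>elementary_abelian_power p n\<^esub> v) w = dot n u w + dot n v w] (mod int p)"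
proof -
  have "[(\<Sum>k<n. (u k + v k) mod int p * w k) = (\<Sum>k<n. u k * w k + v k * w k)] (mod int p)"
    by (intro cong_sum) (simp add: cong_def mod_mult_left_eq distrib_right[symmetric])
  then show ?thesis
    by (simp add: dot_def elementary_abelian_power_def sum.distrib)
qed

lemma dot_mult_right:
  "[dot n w (u \<otimes>\<^bsub>elementary_abelian_power p n\<^esub> v) = dot n w u + dot n w v] (mod int p)"
  using dot_mult_left[of n p u v w] by (simp add: dot_commute[of n w])

lemma dot_one [simp]:
  "dot n \<one>\<^bsub>elementary_abelian_power p n\<^esub> v = 0"
  "dot n v \<one>\<^bsub>elementary_abelian_power p n\<^esub> = 0"
  by (simp_all add: dot_def elementary_abelian_power_def)

text \<open>The vector \<open>c * e_k\<close>, restricted to \<open>{..<n}\<close> because members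
  of the product group are \<open>undefined\<close> elsewhere.\<close>

definition single :: "nat \<Rightarrow> nat \<Rightarrow> int \<Rightarrow> nat \<Rightarrow> int" where
  "single n k c = (\<lambda>j\<in>{..<n}. if j = k then c else 0)"

lemma dot_single: "k < n \<Longrightarrow> dot n u (single n k c) = u k * c"
  by (simp add: dot_def single_def sum.remove[of "{..<n}" k])

lemma carrier_elementary_abelian_power:
  "p > 0 \<Longrightarrow> carrier (elementary_abelian_power p n) = (\<Pi>\<^sub>E k\<in>{..<n}. {0..<int p})"
  by (simp add: elementary_abelian_power_def carrier_integer_mod_group)

lemma single_in_carrier:
  "0 \<le> c \<Longrightarrow> c < int p \<Longrightarrow> single n k c \<in> carrier (elementary_abelian_power p n)"
  by (auto simp: single_def elementary_abelian_power_def carrier_integer_mod_group)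

lemma group_elementary_abelian_power [simp]: "group (elementary_abelian_power p n)"
  by (simp add: elementary_abelian_power_def)

text \<open>Unit vectors read off the entries of \<open>a\<close>, and an entry in
  \<open>{0..<int p}\<close> that \<open>p\<close> divides is zero.\<close>

lemma dot_nondegenerate:
  assumes p: "p > 1" and a: "a \<in> carrier (elementary_abelian_power p n)"
    and 0: "\<forall>b\<in>carrier (elementary_abelian_power p n). int p dvd dot n a b"
  shows "a = \<one>\<^bsub>elementary_abelian_power p n\<^esub>"
proof -
  have aE: "a \<in> (\<Pi>\<^sub>E k\<in>{..<n}. {0..<int p})"
    using a p by (simp add: carrier_elementary_abelian_power)
  have "a k = 0" if k: "k < n" for k
  proof -
    have "int p dvd dot n a (single n k 1)"
      using 0 single_in_carrier[of 1 p] p by auto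
    then have "int p dvd a k"
      using k by (simp add: dot_single)
    moreover have "a k \<in> {0..<int p}"
      using PiE_mem[OF aE] k by simp
    ultimately show ?thesis
      using zdvd_not_zless[of "a k" "int p"] by fastforce
  qed
  then have "a = (\<lambda>k\<in>{..<n}. 0)"
    using PiE_arb[OF aE] by (intro ext) simp
  then show ?thesis
    by (simp add: elementary_abelian_power_def)
qed

lemma (in group) subgroup_annihilator:
  fixes f :: "'c \<Rightarrow> 'a \<Rightarrow> int"
  assumes "\<And>a x y. a \<in> U \<Longrightarrow> x \<in> carrier G \<Longrightarrow> y \<in> carrier G \<Longrightarrow>
      [f a (x \<otimes> y) = f a x + f a y] (mod m)"
  shows "subgroup {b \<in> carrier G. \<forall>a\<in>U. m dvd f a b} G"
proof -
  have one: "m dvd f a \<one>" if "a \<in> U" for a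
    using assms[OF that, of \<one> \<one>] by (simp add: cong_iff_dvd_diff)
  have mult: "m dvd f a (x \<otimes> y) \<longleftrightarrow> m dvd f a x + f a y"
    if "a \<in> U" "x \<in> carrier G" "y \<in> carrier G" for a x y
    using assms[OF that] by (rule cong_dvd_iff)
  show ?thesis
  proof (rule subgroupI)
    fix x assume x: "x \<in> {b \<in> carrier G. \<forall>a\<in>U. m dvd f a b}"
    have "m dvd f a (inv x)" if "a \<in> U" for a
      using mult[OF that, of x "inv x"] x one[OF that] that
      by (simp add: dvd_add_right_iff)
    then show "inv x \<in> {b \<in> carrier G. \<forall>a\<in>U. m dvd f a b}"
      using x by simp
  qed (use one mult in auto)
qed

definition annihilator :: "nat \<Rightarrow> nat \<Rightarrow> (nat \<Rightarrow> int) set \<Rightarrow> (nat \<Rightarrow> int) set" where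
  "annihilator p n S = {t \<in> carrier (elementary_abelian_power p n). \<forall>s\<in>S. int p dvd dot n s t}"

lemma subgroup_dot_annihilator: "subgroup (annihilator p n S) (elementary_abelian_power p n)"
  unfolding annihilator_def
  by (rule group.subgroup_annihilator) (auto intro: dot_mult_right)

lemma finite_elementary_abelian_power:
  "p > 0 \<Longrightarrow> finite (carrier (elementary_abelian_power p n))"
  by (simp add: carrier_elementary_abelian_power finite_PiE)

text \<open>A counting form of the dimension formula for orthogonal complements, drawn from
  character sums rather than linear algebra.\<close>

lemma card_annihilator:
  assumes "p > 1" and "subgroup S (elementary_abelian_power p n)"
  shows "card S * card (annihilator p n S) = card (carrier (elementary_abelian_power p n))"
  unfolding annihilator_def
proof (rule card_subgroup_annihilator)
  fix a assume "a \<in> carrier (elementary_abelian_power p n)"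
    and "\<forall>b\<in>carrier (elementary_abelian_power p n). int p dvd dot n a b"
  then show "a = \<one>\<^bsub>elementary_abelian_power p n\<^esub>"
    by (rule dot_nondegenerate[OF assms(1)])
qed (use assms in \<open>simp_all add: dot_mult_left dot_mult_right finite_elementary_abelian_power\<close>)

section \<open>Matrices with four columns and their commutants\<close>

abbreviation columns :: "nat \<Rightarrow> nat \<Rightarrow> (nat \<Rightarrow> nat \<Rightarrow> int) monoid" where
  "columns p n \<equiv> product_group {..<4} (\<lambda>_. elementary_abelian_power p n)"

abbreviation column_power :: "(nat \<Rightarrow> int) set \<Rightarrow> (nat \<Rightarrow> nat \<Rightarrow> int) set" where
  "column_power S \<equiv> (\<Pi>\<^sub>E i\<in>{..<4}. S)"

definition column :: "nat \<Rightarrow> nat \<Rightarrow> nat \<Rightarrow> (nat \<Rightarrow> int) \<Rightarrow> nat \<Rightarrow> nat \<Rightarrow> int" where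
  "column p n i s = (\<lambda>j\<in>{..<4}. if j = i then s else \<one>\<^bsub>elementary_abelian_power p n\<^esub>)"

lemma column_in_column_power:
  assumes "subgroup S (elementary_abelian_power p n)" and "s \<in> S"
  shows "column p n i s \<in> column_power S"
  using assms by (auto simp: column_def intro: subgroup.one_closed)

lemma column_in_carrier:
  assumes "s \<in> carrier (elementary_abelian_power p n)"
  shows "column p n i s \<in> carrier (columns p n)"
  using column_in_column_power[OF group.subgroup_self assms] by simp

text \<open>The congruence says that the commutator coordinate of columns \<open>i\<close> and
  \<open>j\<close> vanishes; ranging over all ordered pairs lets any two columns be compared
  regardless of their order.\<close>

definition commuting :: "nat \<Rightarrow> nat \<Rightarrow> (nat \<Rightarrow> nat \<Rightarrow> int) \<Rightarrow> (nat \<Rightarrow> nat \<Rightarrow> int) \<Rightarrow> bool" where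
  "commuting p n u v \<longleftrightarrow> (\<forall>i<4. \<forall>j<4. [dot n (u i) (v j) = dot n (u j) (v i)] (mod int p))"

text \<open>Centralizers in the extension are the preimages of such sets, see
  \<open>centralizer_eq\<close>.\<close>

definition commutant :: "nat \<Rightarrow> nat \<Rightarrow> (nat \<Rightarrow> nat \<Rightarrow> int) set \<Rightarrow> (nat \<Rightarrow> nat \<Rightarrow> int) set" where
  "commutant p n U = {v \<in> carrier (columns p n). \<forall>u\<in>U. commuting p n u v}"

lemma commuting_sym: "commuting p n u v \<Longrightarrow> commuting p n v u"
  unfolding commuting_def by (metis cong_sym dot_commute)

text \<open>A single pair of columns would have this form as its only commutator coordinate, and
  every subgroup would attain equality in the cardinality bound; hence two pairs.\<close>

definition symplectic :: "nat \<Rightarrow> (nat \<Rightarrow> nat \<Rightarrow> int) \<Rightarrow> (nat \<Rightarrow> nat \<Rightarrow> int) \<Rightarrow> int" where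
  "symplectic n u v = dot n (u 0) (v 1) - dot n (u 1) (v 0) + dot n (u 2) (v 3) - dot n (u 3) (v 2)"

lemma commutant_subset_symplectic:
  "commutant p n U \<subseteq> {v \<in> carrier (columns p n). \<forall>u\<in>U. int p dvd symplectic n u v}"
proof -
  have "int p dvd symplectic n u v" if "commuting p n u v" for u v
  proof -
    have "[dot n (u 0) (v 1) = dot n (u 1) (v 0)] (mod int p)"
      "[dot n (u 2) (v 3) = dot n (u 3) (v 2)] (mod int p)"
      using that unfolding commuting_def by simp_all
    then show ?thesis
      unfolding symplectic_def cong_iff_dvd_diff by (metis add_diff_eq dvd_add)
  qed
  then show ?thesis unfolding commutant_def by blast
qed

lemma finite_columns: "p > 0 \<Longrightarrow> finite (carrier (columns p n))"
  by (simp add: finite_PiE finite_elementary_abelian_power)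

lemma group_columns [simp]: "group (columns p n)"
  by simp

text \<open>Columns are paired as 0 with 1 and 2 with 3. A vector supported in the partner column
  isolates \<open>u i\<close>, up to a sign that divisibility ignores.\<close>

lemma symplectic_column:
  assumes "i < 4" and i': "i' = (if even i then i + 1 else i - 1)"
  shows "int p dvd symplectic n u (column p n i' t) \<longleftrightarrow> int p dvd dot n (u i) t"
proof -
  consider "i = 0" | "i = 1" | "i = 2" | "i = 3" using assms by linarith
  then show ?thesis
    by cases (simp_all add: i' symplectic_def column_def)
qed

text \<open>\<open>card_subgroup_annihilator\<close> applies with both groups equal to
  \<open>columns p n\<close>; nondegeneracy follows column by column by testing against vectors in
  the partner column.\<close>

lemma card_symplectic:
  assumes p: "p > 1" and U: "subgroup U (columns p n)"
  shows "card U * card {v \<in> carrier (columns p n). \<forall>u\<in>U. int p dvd symplectic n u v} =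
    card (carrier (columns p n))"
proof (rule card_subgroup_annihilator)
  fix x y b assume "x \<in> carrier (columns p n)" "y \<in> carrier (columns p n)" "b \<in> carrier (columns p n)"
  show "[symplectic n (x \<otimes>\<^bsub>columns p n\<^esub> y) b = symplectic n x b + symplectic n y b] (mod int p)"
  proof -
    have "[symplectic n (x \<otimes>\<^bsub>columns p n\<^esub> y) b =
      (dot n (x 0) (b 1) + dot n (y 0) (b 1)) - (dot n (x 1) (b 0) + dot n (y 1) (b 0)) +
      (dot n (x 2) (b 3) + dot n (y 2) (b 3)) - (dot n (x 3) (b 2) + dot n (y 3) (b 2))] (mod int p)"
      unfolding symplectic_def by (intro cong_diff cong_add) (simp_all add: dot_mult_left)
    also have "(dot n (x 0) (b 1) + dot n (y 0) (b 1)) - (dot n (x 1) (b 0) + dot n (y 1) (b 0)) +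
      (dot n (x 2) (b 3) + dot n (y 2) (b 3)) - (dot n (x 3) (b 2) + dot n (y 3) (b 2)) =
      symplectic n x b + symplectic n y b"
      unfolding symplectic_def by linarith
    finally show ?thesis .
  qed
  show "[symplectic n b (x \<otimes>\<^bsub>columns p n\<^esub> y) = symplectic n b x + symplectic n b y] (mod int p)"
  proof -
    have "[symplectic n b (x \<otimes>\<^bsub>columns p n\<^esub> y) =
      (dot n (b 0) (x 1) + dot n (b 0) (y 1)) - (dot n (b 1) (x 0) + dot n (b 1) (y 0)) +
      (dot n (b 2) (x 3) + dot n (b 2) (y 3)) - (dot n (b 3) (x 2) + dot n (b 3) (y 2))] (mod int p)"
      unfolding symplectic_def by (intro cong_diff cong_add) (simp_all add: dot_mult_right)
    also have "(dot n (b 0) (x 1) + dot n (b 0) (y 1)) - (dot n (b 1) (x 0) + dot n (b 1) (y 0)) +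
      (dot n (b 2) (x 3) + dot n (b 2) (y 3)) - (dot n (b 3) (x 2) + dot n (b 3) (y 2)) =
      symplectic n b x + symplectic n b y"
      unfolding symplectic_def by linarith
    finally show ?thesis .
  qed
next
  fix a assume a: "a \<in> carrier (columns p n)"
    and 0: "\<forall>b\<in>carrier (columns p n). int p dvd symplectic n a b"
  have "a i = \<one>\<^bsub>elementary_abelian_power p n\<^esub>" if i: "i < 4" for i
  proof (rule dot_nondegenerate[OF p])
    show "a i \<in> carrier (elementary_abelian_power p n)" using a i by auto
    show "\<forall>b\<in>carrier (elementary_abelian_power p n). int p dvd dot n (a i) b"
      using 0 symplectic_column[OF i refl] column_in_carrier by blast
  qed
  moreover have "a i = undefined" if "\<not> i < 4" for i
    using a that PiE_arb[of a "{..<4}"] by simp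
  ultimately show "a = \<one>\<^bsub>columns p n\<^esub>"
    by (intro ext) simp
next
  show "finite (carrier (columns p n))" "finite (carrier (columns p n))"
    using p by (intro finite_columns; simp)+
next
  show "subgroup U (columns p n)" by (rule U)
next
  show "p > 0" using p by simp
qed (rule group_columns)+

text \<open>A vector of \<open>S\<close> placed in one column, with zeros elsewhere, reduces a
  commuting relation to a single product, which must therefore vanish. Conversely, vanishing
  products make every relation hold.\<close>

lemma commutant_column_power:
  assumes S: "subgroup S (elementary_abelian_power p n)"
  shows "commutant p n (column_power S) = column_power (annihilator p n S)"
proof (intro equalityI subsetI)
  fix v assume v: "v \<in> commutant p n (column_power S)"
  have "int p dvd dot n s (v j)" if "s \<in> S" "j < 4" for s j
  proof -
    \<comment> \<open>Any index different from \<open>j\<close> would do: the test vector is then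
      zero in column \<open>j\<close>, which kills the other side of the relation.\<close>
    define i :: nat where "i = (if j = 0 then 1 else 0)"
    have i: "i < 4" "i \<noteq> j" by (auto simp: i_def)
    have "commuting p n (column p n i s) v"
      using v column_in_column_power[OF S that(1)] unfolding commutant_def by blast
    then have "[dot n (column p n i s i) (v j) = dot n (column p n i s j) (v i)] (mod int p)"
      unfolding commuting_def using i that by blast
    then have "[dot n s (v j) = 0] (mod int p)"
      using i that by (simp add: column_def)
    then show ?thesis by (simp add: cong_0_iff)
  qed
  then show "v \<in> column_power (annihilator p n S)"
    using v unfolding commutant_def annihilator_def by (auto simp: PiE_iff)
next
  fix v assume v: "v \<in> column_power (annihilator p n S)"
  have "commuting p n u v" if "u \<in> column_power S" for u
    unfolding commuting_def
  proof (intro allI impI)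
    fix i j :: nat assume "i < 4" "j < 4"
    then have "int p dvd dot n (u i) (v j)" "int p dvd dot n (u j) (v i)"
      using v that by (auto simp: annihilator_def PiE_iff)
    then show "[dot n (u i) (v j) = dot n (u j) (v i)] (mod int p)"
      by (simp add: cong_iff_dvd_diff)
  qed
  then show "v \<in> commutant p n (column_power S)"
    using v unfolding commutant_def by (auto simp: annihilator_def PiE_iff)
qed

text \<open>This is the fourth power of the identity \<open>card_annihilator\<close>.\<close>

lemma card_commutant_column_power:
  assumes p: "p > 1" and S: "subgroup S (elementary_abelian_power p n)"
  shows "card (column_power S) * card (commutant p n (column_power S)) = card (carrier (columns p n))"
proof -
  have card: "card (column_power T) = card T ^ 4" for T
    by (simp add: card_PiE)
  show ?thesis
    unfolding commutant_column_power[OF S] carrier_product_group card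
    by (simp only: power_mult_distrib[symmetric] card_annihilator[OF p S])
qed

section \<open>The bound for commutants and its equality case\<close>

lemma card_commutant_le:
  assumes p: "p > 1" and U: "subgroup U (columns p n)"
  shows "card U * card (commutant p n U) \<le> card (carrier (columns p n))"
proof -
  let ?A = "{v \<in> carrier (columns p n). \<forall>u\<in>U. int p dvd symplectic n u v}"
  have "finite (carrier (columns p n))"
    using p by (intro finite_columns) simp
  then have "finite ?A"
    by (rule rev_finite_subset) blast
  then have "card (commutant p n U) \<le> card ?A"
    using commutant_subset_symplectic by (rule card_mono)
  then have "card U * card (commutant p n U) \<le> card U * card ?A"
    by (rule mult_le_mono2)
  then show ?thesis
    unfolding card_symplectic[OF p U] .
qed

text \<open>If equality holds, the commutant \<open>P\<close> is the whole symplectic complement of \<open>U\<close>. So \<open>P\<close> contains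
  \<open>(v\<^sub>0, v\<^sub>1, 0, 0)\<close> for each \<open>v \<in> P\<close>, and it contains \<open>column p n a' t\<close> once \<open>u\<^sub>a \<cdot> t\<close> vanishes on \<open>U\<close>, where
  \<open>a'\<close> is the symplectic partner of \<open>a\<close>. Applying the other coordinate forms to these elements shows
  that all products vanish.\<close>

lemma card_commutant_eq_imp_column_power:
  assumes p: "p > 1" and U: "subgroup U (columns p n)"
    and eq: "card U * card (commutant p n U) = card (carrier (columns p n))"
  shows "\<exists>S. subgroup S (elementary_abelian_power p n) \<and> U = column_power S"
proof -
  let ?E = "elementary_abelian_power p n" and ?V = "columns p n"
  define P where "P = commutant p n U"
  have finV: "finite (carrier ?V)" using p finite_columns by simp
  have UV: "U \<subseteq> carrier ?V" using U by (rule subgroup.subset)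
  have "card U > 0"
    using finite_subset[OF UV finV] subgroup.one_closed[OF U] by (auto simp: card_gt_0_iff)
  moreover have "card U * card P = card U * card {v \<in> carrier ?V. \<forall>u\<in>U. int p dvd symplectic n u v}"
    unfolding P_def using card_symplectic[OF p U] eq by (simp only:)
  ultimately have "card P = card {v \<in> carrier ?V. \<forall>u\<in>U. int p dvd symplectic n u v}"
    using nat_mult_eq_cancel1 by blast
  moreover have "finite {v \<in> carrier ?V. \<forall>u\<in>U. int p dvd symplectic n u v}"
    using finV by (rule rev_finite_subset) blast
  \<comment> \<open>\<open>P\<close> sits inside the finite symplectic complement and has as many
    elements, so the inclusion is an equality.\<close>
  ultimately have P: "P = {v \<in> carrier ?V. \<forall>u\<in>U. int p dvd symplectic n u v}"
    using card_subset_eq commutant_subset_symplectic unfolding P_def by meson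
  have comm: "[dot n (u i) (v j) = dot n (u j) (v i)] (mod int p)"
    if "v \<in> P" "u \<in> U" "i < 4" "j < 4" for u v i j
    using that unfolding P_def commutant_def commuting_def by blast
  \<comment> \<open>Comparing columns \<open>i\<close> and \<open>a'\<close> of the test vector
    \<open>column p n a' t\<close> leaves only the product of \<open>u i\<close> with
    \<open>t\<close>. The choice \<open>i = a'\<close> would give a trivial relation, which is why
    the partner is excluded.\<close>
  have step: "int p dvd dot n (u i) t"
    if t: "t \<in> carrier ?E" and a: "a < 4" "\<forall>u\<in>U. int p dvd dot n (u a) t"
      and i: "i < 4" "i \<noteq> (if even a then a + 1 else a - 1)" and u: "u \<in> U" for u i a t
  proof -
    define a' where "a' = (if even a then a + 1 else a - 1)"
    have a': "a' < 4" using a(1) unfolding a'_def by presburger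
    have "column p n a' t \<in> P"
      using t a column_in_carrier symplectic_column[OF a(1) a'_def] unfolding P by blast
    then have "[dot n (u i) (column p n a' t a') = dot n (u a') (column p n a' t i)] (mod int p)"
      using u i(1) a' by (rule comm)
    moreover have "i \<noteq> a'"
      using i(2) unfolding a'_def .
    ultimately show ?thesis
      using i(1) a' by (simp add: column_def cong_0_iff)
  qed
  have all: "int p dvd dot n (u i) t"
    if t: "t \<in> carrier ?E" and a: "a < 4" "\<forall>u\<in>U. int p dvd dot n (u a) t"
      and i: "i < 4" and u: "u \<in> U" for u i a t
  proof (cases "i = (if even a then a + 1 else a - 1)")
    case True
    \<comment> \<open>The partner of \<open>a\<close> is reached in two steps through a column
      \<open>b\<close> of the other pair: \<open>b\<close> is not the partner of \<open>a\<close>,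
      and \<open>i\<close> is not the partner of \<open>b\<close>.\<close>
    define b :: nat where "b = (if a < 2 then 2 else 0)"
    have "a = 0 \<or> a = 1 \<or> a = 2 \<or> a = 3"
      using a(1) by auto
    then have "b < 4" "b \<noteq> (if even a then a + 1 else a - 1)" "i \<noteq> (if even b then b + 1 else b - 1)"
      using True unfolding b_def by auto
    then show ?thesis using step[OF t] a i u by blast
  qed (use step[OF t a i] u in blast)
  have orth: "int p dvd dot n (u i) (v j)"
    if v: "v \<in> P" and u: "u \<in> U" and i: "i < 4" and j: "j < 4" for u v i j
  proof -
    \<comment> \<open>Truncating \<open>v\<close> to its first pair turns the symplectic product
      with \<open>w\<close> into the coordinate \<open>(0, 1)\<close> of the commutator with
      \<open>v\<close>, which vanishes; hence \<open>w\<close> is again in \<open>P\<close>.\<close>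
    define w where "w = (\<lambda>k\<in>{..<4::nat}. if k < 2 then v k else \<one>\<^bsub>?E\<^esub>)"
    have vE: "v k \<in> carrier ?E" if "k < 4" for k
      using v that unfolding P by auto
    have "int p dvd symplectic n x w" if x: "x \<in> U" for x
      using comm[OF v x, of 0 1] by (simp add: symplectic_def w_def cong_iff_dvd_diff)
    moreover have "w \<in> carrier ?V"
      using vE by (auto simp: w_def group.is_monoid monoid.one_closed)
    ultimately have w: "w \<in> P" unfolding P by blast
    \<comment> \<open>Columns 2 and \<open>k\<close> are compared: \<open>w\<close> agrees with
      \<open>v\<close> in column \<open>k\<close> and is zero in column 2.\<close>
    have 2: "int p dvd dot n (x 2) (v k)" if "x \<in> U" "k < 2" for x k
      using comm[OF w that(1), of 2 k] that(2) by (simp add: w_def cong_0_iff)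
    have 0: "int p dvd dot n (x i) (v 0)" if "x \<in> U" "i < 4" for x i
      using all[OF vE, of 0 2] 2[of _ 0] that by simp
    \<comment> \<open>By \<open>all\<close>, a single column \<open>a\<close> with vanishing
      products throughout \<open>U\<close> suffices.\<close>
    have "\<exists>a<4. \<forall>x\<in>U. int p dvd dot n (x a) (v j)"
    proof (cases "j < 2")
      case True
      then show ?thesis using 2 by (intro exI[of _ 2]) auto
    next
      case False
      \<comment> \<open>The relation between columns 0 and \<open>j\<close> exchanges this product
        for one with \<open>v 0\<close>, already known to vanish.\<close>
      have "int p dvd dot n (x 0) (v j)" if "x \<in> U" for x
        using cong_dvd_iff[OF comm[OF v that, of 0 j]] 0[OF that j] j by simp
      then show ?thesis by (intro exI[of _ 0]) auto
    qed
    then show ?thesis using all[OF vE] i j u by blast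
  qed
  \<comment> \<open>\<open>T\<close> annihilates all columns of elements of \<open>U\<close>. One
    inclusion between \<open>P\<close> and \<open>column_power T\<close> is \<open>orth\<close>; the
    other holds because a symplectic product is a signed sum of such products.\<close>
  define T where "T = annihilator p n {u i | u i. u \<in> U \<and> i < 4}"
  have T: "subgroup T ?E" unfolding T_def by (rule subgroup_dot_annihilator)
  have PT: "P = column_power T"
  proof (intro equalityI subsetI)
    fix v assume v: "v \<in> P"
    then have "v \<in> carrier ?V" unfolding P by simp
    then show "v \<in> column_power T"
      using orth[OF v] unfolding T_def annihilator_def by (auto simp: PiE_iff)
  next
    fix v assume v: "v \<in> column_power T"
    then have "int p dvd dot n (u i) (v j)" if "u \<in> U" "i < 4" "j < 4" for u i j
      using that unfolding T_def annihilator_def by (auto simp: PiE_iff)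
    then have "int p dvd symplectic n u v" if "u \<in> U" for u
      using that unfolding symplectic_def by (intro dvd_add dvd_diff) auto
    moreover have "v \<in> carrier ?V"
      using v unfolding T_def annihilator_def by (auto simp: PiE_iff)
    ultimately show "v \<in> P" unfolding P by blast
  qed
  have "U \<subseteq> commutant p n P"
    using UV unfolding P_def commutant_def by (auto intro: commuting_sym)
  \<comment> \<open>\<open>P\<close> is a fourth power, so it attains equality too. Hence
    \<open>U\<close> and its double commutant have equal size.\<close>
  moreover have "card U = card (commutant p n P)"
  proof -
    have "card P * card (commutant p n P) = card P * card U"
      unfolding PT card_commutant_column_power[OF p T]
      using eq by (simp add: P_def[symmetric] PT mult.commute)
    moreover have "card P > 0"
      using eq finV \<open>card U > 0\<close> unfolding P_def[symmetric]
      by (metis card_gt_0_iff empty_iff group.subgroup_self group_columns mult_is_0 not_gr_zero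
          subgroup.one_closed)
    ultimately show ?thesis by simp
  qed
  moreover have "finite (commutant p n P)"
    using finV unfolding commutant_def by simp
  ultimately have "U = commutant p n P"
    by (intro card_subset_eq) auto
  then have "U = column_power (annihilator p n T)"
    unfolding PT commutant_column_power[OF T] .
  then show ?thesis using subgroup_dot_annihilator by blast
qed

section \<open>Center, commutators and maximal subgroups\<close>

lemma mem_group_center_iff:
  "z \<in> group_center G \<longleftrightarrow> z \<in> carrier G \<and> (\<forall>a\<in>carrier G. z \<otimes>\<^bsub>G\<^esub> a = a \<otimes>\<^bsub>G\<^esub> z)"
  unfolding group_center_def centralizer_def by blast

lemma (in group) subgroup_group_center: "subgroup (group_center G) G"
proof (rule subgroupI)
  fix z assume z: "z \<in> group_center G"
  have "inv z \<otimes> a = a \<otimes> inv z" if "a \<in> carrier G" for a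
  proof -
    have c: "z \<in> carrier G" "z \<otimes> inv a = inv a \<otimes> z"
      using z that unfolding mem_group_center_iff by (blast, meson inv_closed)
    have "inv z \<otimes> a = inv (inv a \<otimes> z)"
      using c(1) that by (simp add: inv_mult_group)
    also have "\<dots> = inv (z \<otimes> inv a)"
      using c(2) by simp
    also have "\<dots> = a \<otimes> inv z"
      using c(1) that by (simp add: inv_mult_group)
    finally show ?thesis .
  qed
  then show "inv z \<in> group_center G"
    using z inv_closed unfolding mem_group_center_iff by blast
next
  fix y z assume yz: "y \<in> group_center G" "z \<in> group_center G"
  have "y \<otimes> z \<otimes> a = a \<otimes> (y \<otimes> z)" if "a \<in> carrier G" for a
  proof -
    have c: "y \<in> carrier G" "z \<in> carrier G" "y \<otimes> a = a \<otimes> y" "z \<otimes> a = a \<otimes> z"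
      using yz that unfolding mem_group_center_iff by blast+
    have "y \<otimes> z \<otimes> a = y \<otimes> (a \<otimes> z)"
      using c(1,2) that unfolding c(4)[symmetric] by (rule m_assoc)
    also have "\<dots> = y \<otimes> a \<otimes> z"
      using c(1,2) that by (simp add: m_assoc)
    also have "\<dots> = a \<otimes> (y \<otimes> z)"
      unfolding c(3) using that c(1,2) by (rule m_assoc)
    finally show ?thesis .
  qed
  then show "y \<otimes> z \<in> group_center G"
    using yz m_closed unfolding mem_group_center_iff by blast
next
  have "\<one> \<in> group_center G"
    by (simp add: mem_group_center_iff)
  then show "group_center G \<noteq> {}" by blast
  show "group_center G \<subseteq> carrier G"
    unfolding group_center_def centralizer_def by blast
qed

lemma (in group) center_commute:
  assumes "z \<in> group_center G" "a \<in> carrier G"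
  shows "z \<otimes> a = a \<otimes> z"
  using assms unfolding mem_group_center_iff by blast

lemma (in group) mult_exchange:
  assumes "a \<in> carrier G" "b \<in> carrier G" "c \<in> carrier G" "d \<in> carrier G" "b \<otimes> c = c \<otimes> b"
  shows "(a \<otimes> b) \<otimes> (c \<otimes> d) = (a \<otimes> c) \<otimes> (b \<otimes> d)"
proof -
  have "(a \<otimes> b) \<otimes> (c \<otimes> d) = a \<otimes> (b \<otimes> c) \<otimes> d"
    using assms(1-4) by (simp add: m_assoc)
  also have "\<dots> = a \<otimes> (c \<otimes> b) \<otimes> d"
    using assms(5) by simp
  also have "\<dots> = (a \<otimes> c) \<otimes> (b \<otimes> d)"
    using assms(1-4) by (simp add: m_assoc)
  finally show ?thesis .
qed

lemma (in group) subgroup_mult_center: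
  assumes M: "subgroup M G"
  shows "subgroup {m \<otimes> z | m z. m \<in> M \<and> z \<in> group_center G} G"
proof (rule subgroupI)
  note Mc = subgroup.mem_carrier[OF M] and Zc = subgroup.mem_carrier[OF subgroup_group_center]
  show "{m \<otimes> z | m z. m \<in> M \<and> z \<in> group_center G} \<subseteq> carrier G"
    using Mc Zc by auto
  show "{m \<otimes> z | m z. m \<in> M \<and> z \<in> group_center G} \<noteq> {}"
    using subgroup.one_closed[OF M] subgroup.one_closed[OF subgroup_group_center] by blast
  fix a assume "a \<in> {m \<otimes> z | m z. m \<in> M \<and> z \<in> group_center G}"
  then obtain m z where mz: "a = m \<otimes> z" "m \<in> M" "z \<in> group_center G" by blast
  have inv: "inv m \<in> M" "inv z \<in> group_center G"
    using mz M subgroup_group_center by (simp_all add: subgroup.m_inv_closed)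
  have "inv a = inv m \<otimes> inv z"
    using mz Mc Zc center_commute[OF inv(2), of "inv m"] by (simp add: inv_mult_group)
  then show "inv a \<in> {m \<otimes> z | m z. m \<in> M \<and> z \<in> group_center G}"
    using inv by blast
  fix b assume "b \<in> {m \<otimes> z | m z. m \<in> M \<and> z \<in> group_center G}"
  then obtain m' z' where mz': "b = m' \<otimes> z'" "m' \<in> M" "z' \<in> group_center G" by blast
  have "a \<otimes> b = (m \<otimes> m') \<otimes> (z \<otimes> z')"
    unfolding mz mz' using mz(2,3) mz'(2,3)
    by (intro mult_exchange center_commute Mc Zc)
  then show "a \<otimes> b \<in> {m \<otimes> z | m z. m \<in> M \<and> z \<in> group_center G}"
    using subgroup.m_closed[OF M mz(2) mz'(2)] subgroup.m_closed[OF subgroup_group_center mz(3) mz'(3)]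
    by blast
qed

lemma (in group) commutator_eqI:
  assumes "c \<in> carrier G" "x \<in> carrier G" "y \<in> carrier G" "x \<otimes> y = c \<otimes> (y \<otimes> x)"
  shows "x \<otimes> y \<otimes> inv x \<otimes> inv y = c"
proof -
  have "x \<otimes> y \<otimes> inv x \<otimes> inv y = c \<otimes> (y \<otimes> x) \<otimes> inv x \<otimes> inv y"
    using assms(4) by simp
  then show ?thesis
    using assms(1-3) by (simp add: m_assoc)
qed

text \<open>If a maximal subgroup \<open>M\<close> misses a central element then \<open>G = M Z(G)\<close>, so \<open>G\<close> and \<open>M\<close> have the
  same commutators.\<close>

lemma (in group) center_inter_derived_subset_frattini:
  "group_center G \<inter> derived G (carrier G) \<subseteq> frattini_subgroup G"
proof -
  have "x \<in> M" if x: "x \<in> group_center G" "x \<in> derived G (carrier G)" and M: "maximal_subgroup M G"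
    for x M
  proof (rule ccontr)
    assume "x \<notin> M"
    have sub: "subgroup M G" using M unfolding maximal_subgroup_def by blast
    note Mc = subgroup.mem_carrier[OF sub] and Zc = subgroup.mem_carrier[OF subgroup_group_center]
    let ?N = "{m \<otimes> z | m z. m \<in> M \<and> z \<in> group_center G}"
    have "m \<in> ?N" if "m \<in> M" for m
      using that Mc r_one[of m] subgroup.one_closed[OF subgroup_group_center] by force
    moreover have "x \<in> ?N"
      using x(1) Zc l_one[of x] subgroup.one_closed[OF sub] by force
    ultimately have N: "?N = carrier G"
      using M subgroup_mult_center[OF sub] \<open>x \<notin> M\<close> unfolding maximal_subgroup_def by blast
    have "a \<otimes> b \<otimes> inv a \<otimes> inv b \<in> M" if ab: "a \<in> carrier G" "b \<in> carrier G" for a b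
    proof -
      obtain m z where mz: "a = m \<otimes> z" "m \<in> M" "z \<in> group_center G" using N ab by blast
      obtain m' z' where mz': "b = m' \<otimes> z'" "m' \<in> M" "z' \<in> group_center G" using N ab by blast
      note c = Mc[OF mz(2)] Mc[OF mz'(2)] Zc[OF mz(3)] Zc[OF mz'(3)]
      \<comment> \<open>The central factors \<open>z\<close> and \<open>z'\<close> drop out, so
        \<open>d\<close> is also the commutator of \<open>a\<close> and \<open>b\<close>, and it
        lies in \<open>M\<close>.\<close>
      define d where "d = m \<otimes> m' \<otimes> inv m \<otimes> inv m'"
      have d: "d \<in> M"
        unfolding d_def using mz(2) mz'(2) by (intro subgroup.m_closed[OF sub] subgroup.m_inv_closed[OF sub])
      have "a \<otimes> b = (m \<otimes> m') \<otimes> (z \<otimes> z')"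
        unfolding mz mz' using c center_commute[OF mz(3) c(2)] by (intro mult_exchange)
      also have "m \<otimes> m' = d \<otimes> (m' \<otimes> m)"
      proof -
        have "d = (m \<otimes> m') \<otimes> inv (m' \<otimes> m)"
          unfolding d_def using c by (simp add: inv_mult_group m_assoc)
        then show ?thesis
          using c by (simp add: m_assoc del: inv_mult_group)
      qed
      also have "z \<otimes> z' = z' \<otimes> z"
        using center_commute[OF mz(3) c(4)] .
      also have "d \<otimes> (m' \<otimes> m) \<otimes> (z' \<otimes> z) = d \<otimes> ((m' \<otimes> m) \<otimes> (z' \<otimes> z))"
        using c Mc[OF d] by (intro m_assoc m_closed)
      also have "(m' \<otimes> m) \<otimes> (z' \<otimes> z) = b \<otimes> a"
        unfolding mz mz' using c center_commute[OF mz'(3) c(1)] by (intro mult_exchange[symmetric])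
      finally show ?thesis
        using commutator_eqI[OF Mc[OF d] ab] d by simp
    qed
    then have "derived G (carrier G) \<subseteq> M"
      unfolding derived_def by (intro generate_subgroup_incl[OF _ sub]) auto
    then show False using x \<open>x \<notin> M\<close> by blast
  qed
  moreover have "group_center G \<subseteq> carrier G"
    unfolding group_center_def centralizer_def by blast
  ultimately show ?thesis
    unfolding frattini_subgroup_def by blast
qed

section \<open>Preimages under homomorphisms and two kernels\<close>

lemma (in group_hom) card_vimage_surj:
  assumes fin: "finite (carrier G)" and surj: "h ` carrier G = carrier H" and S: "S \<subseteq> carrier H"
  shows "card {x \<in> carrier G. h x \<in> S} = card (kernel G H h) * card S"
proof -
  \<comment> \<open>Each fibre of \<open>h\<close> is a left coset of the kernel.\<close>
  have "card {x \<in> carrier G. h x = v} = card (kernel G H h)" if "v \<in> S" for v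
  proof -
    obtain g where g: "g \<in> carrier G" "v = h g"
      using \<open>v \<in> S\<close> S surj by blast
    have "{x \<in> carrier G. h x = v} = (\<lambda>k. g \<otimes> k) ` kernel G H h"
    proof (intro equalityI subsetI)
      fix x assume "x \<in> {x \<in> carrier G. h x = v}"
      then have x: "x \<in> carrier G" "h x = h g"
        using g(2) by auto
      have "inv g \<otimes> x \<in> kernel G H h"
        using g(1) x by (simp add: kernel_def)
      moreover have "x = g \<otimes> (inv g \<otimes> x)"
        using g(1) x(1) by (metis G.inv_closed G.l_one G.m_assoc G.r_inv)
      ultimately show "x \<in> (\<lambda>k. g \<otimes> k) ` kernel G H h"
        by (rule rev_image_eqI)
    next
      fix x assume "x \<in> (\<lambda>k. g \<otimes> k) ` kernel G H h"
      then obtain k where "k \<in> carrier G" "h k = \<one>\<^bsub>H\<^esub>" "x = g \<otimes> k"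
        unfolding kernel_def by blast
      then show "x \<in> {x \<in> carrier G. h x = v}"
        using g by simp
    qed
    moreover have "inj_on (\<lambda>k. g \<otimes> k) (kernel G H h)"
      using g by (auto simp: inj_on_def kernel_def)
    ultimately show ?thesis by (simp add: card_image)
  qed
  moreover have "finite S"
    using S surj fin by (metis finite_imageI finite_subset)
  moreover have "{x \<in> carrier G. h x \<in> S} = (\<Union>v\<in>S. {x \<in> carrier G. h x = v})" by blast
  moreover have "card (\<Union>v\<in>S. {x \<in> carrier G. h x = v}) = (\<Sum>v\<in>S. card {x \<in> carrier G. h x = v})"
    using fin \<open>finite S\<close> by (intro card_UN_disjoint) auto
  ultimately show ?thesis
    by simp
qed

lemma (in group_hom) subgroup_vimage:
  assumes "subgroup S H"
  shows "subgroup {x \<in> carrier G. h x \<in> S} G"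
proof (rule G.subgroupI)
  show "{x \<in> carrier G. h x \<in> S} \<noteq> {}"
    using subgroup.one_closed[OF assms] by force
qed (auto intro: subgroup.m_closed[OF assms] subgroup.m_inv_closed[OF assms])

lemma annihilator_carrier:
  assumes "p > 1"
  shows "annihilator p n (carrier (elementary_abelian_power p n)) = {\<one>\<^bsub>elementary_abelian_power p n\<^esub>}"
proof (intro equalityI subsetI)
  fix t assume t: "t \<in> annihilator p n (carrier (elementary_abelian_power p n))"
  then have "\<forall>s\<in>carrier (elementary_abelian_power p n). int p dvd dot n t s"
    unfolding annihilator_def dot_commute[of n t] by blast
  then have "t = \<one>\<^bsub>elementary_abelian_power p n\<^esub>"
    using t dot_nondegenerate[OF assms] unfolding annihilator_def by blast
  then show "t \<in> {\<one>\<^bsub>elementary_abelian_power p n\<^esub>}"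
    by (rule ssubst) (rule singletonI)
next
  fix t assume "t \<in> {\<one>\<^bsub>elementary_abelian_power p n\<^esub>}"
  then show "t \<in> annihilator p n (carrier (elementary_abelian_power p n))"
    using subgroup.one_closed[OF subgroup_dot_annihilator] by blast
qed

text \<open>The case of the whole column space, whose annihilator is trivial. It makes the center of
  the extension equal to the kernel of the projection.\<close>

lemma commutant_carrier:
  assumes "p > 1"
  shows "commutant p n (carrier (columns p n)) = {\<one>\<^bsub>columns p n\<^esub>}"
proof -
  have "commutant p n (carrier (columns p n)) = column_power {\<one>\<^bsub>elementary_abelian_power p n\<^esub>}"
    unfolding carrier_product_group annihilator_carrier[OF assms, symmetric]
    by (rule commutant_column_power[OF group.subgroup_self[OF group_elementary_abelian_power]])
  also have "\<dots> = {\<one>\<^bsub>columns p n\<^esub>}"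
    by (simp add: PiE_eq_singleton)
  finally show ?thesis .
qed

text \<open>An element outside the kernel has invertible image modulo the prime \<open>p\<close>, so
  its powers move any given group element into the kernel. A strictly larger subgroup is therefore
  everything.\<close>

lemma (in group) maximal_subgroup_kernel:
  assumes p: "Factorial_Ring.prime p" and q: "q \<in> hom G (integer_mod_group p)"
    and x: "x \<in> carrier G" "q x \<noteq> 0"
  shows "maximal_subgroup (kernel G (integer_mod_group p) q) G"
proof -
  let ?M = "kernel G (integer_mod_group p) q"
  have p0: "p > 0" using p by (rule prime_gt_0_nat)
  interpret q: group_hom G "integer_mod_group p" q
    by (intro group_hom.intro group_hom_axioms.intro q is_group group_integer_mod_group)
  have mult: "q (g \<otimes> y) = (q g + q y) mod int p" if "g \<in> carrier G" "y \<in> carrier G" for g y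
    using q.hom_mult[OF that] by simp
  have "H = carrier G" if H: "subgroup H G" and MH: "?M \<subseteq> H" and neq: "H \<noteq> ?M" for H
  proof -
    note Hc = subgroup.mem_carrier[OF H]
    obtain y where y: "y \<in> H" "y \<notin> ?M"
      using MH neq by blast
    have yc: "y \<in> carrier G" using Hc[OF y(1)] .
    have "q y \<noteq> 0" using y(2) yc by (simp add: kernel_def)
    moreover have "q y \<in> {0..<int p}"
      using q.hom_closed[OF yc] p0 by (simp add: carrier_integer_mod_group)
    ultimately have "\<not> int p dvd q y"
      using zdvd_not_zless[of "q y" "int p"] by fastforce
    then have "coprime (int p) (q y)"
      using p by (intro prime_imp_coprime) simp_all
    then obtain c where c: "[q y * c = 1] (mod int p)"
      using cong_solve_coprime_int[of "q y" "int p"] by (auto simp: coprime_commute)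
    have "g \<in> H" if g: "g \<in> carrier G" for g
    proof -
      \<comment> \<open>As \<open>c\<close> inverts \<open>q y\<close> modulo \<open>p\<close>, the
        natural number \<open>m\<close> represents \<open>- q g / q y\<close>.\<close>
      define m where "m = nat ((- q g * c) mod int p)"
      have "int m = (- q g * c) mod int p"
        unfolding m_def using p0 by simp
      then have m: "[int m = - q g * c] (mod int p)"
        by (simp add: cong_def)
      have "[q g + int m * q y = q g + (- q g * c) * q y] (mod int p)"
        by (intro cong_add cong_mult m cong_refl)
      also have "q g + (- q g * c) * q y = q g * (1 - q y * c)"
        by (simp add: right_diff_distrib)
      also have "[q g * (1 - q y * c) = q g * (1 - 1)] (mod int p)"
        by (intro cong_mult cong_diff c cong_refl)
      finally have "(q g + int m * q y) mod int p = 0"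
        by (simp add: cong_def)
      moreover have "q (y [^] m) = int m * q y mod int p"
        using q.hom_nat_pow[OF yc, of m] by simp
      ultimately have "q (g \<otimes> y [^] m) = 0"
        using mult[OF g nat_pow_closed[OF yc, of m]] by (simp add: mod_add_right_eq)
      then have gy: "g \<otimes> y [^] m \<in> H"
        using MH g yc unfolding kernel_def by auto
      have ym: "y [^] m \<in> H"
      proof (induction m)
        case 0
        then show ?case using subgroup.one_closed[OF H] by simp
      next
        case (Suc m)
        then show ?case using subgroup.m_closed[OF H _ y(1)] by simp
      qed
      have "(g \<otimes> y [^] m) \<otimes> inv (y [^] m) = g"
        using g yc by (simp add: m_assoc)
      then show ?thesis
        using subgroup.m_closed[OF H gy subgroup.m_inv_closed[OF H ym]] by simp
    qed
    then show ?thesis using subgroup.subset[OF H] by blast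
  qed
  moreover have "?M \<noteq> carrier G"
    using x unfolding kernel_def by auto
  ultimately show ?thesis
    unfolding maximal_subgroup_def using q.subgroup_kernel by blast
qed

section \<open>The Chermak-Delgado lattice of the extension\<close>

text \<open>What the lattice computation requires of the extension, phrased for an abstract
  projection \<open>h\<close>. The clauses are invariant under isomorphism, so the results pass to a
  copy on the natural numbers.\<close>

locale commuting_extension = group_hom G "columns p n" h
  for G :: "('a, 'b) monoid_scheme" (structure) and p n h +
  assumes prime: "Factorial_Ring.prime p" and n_pos: "n > 0"
    and finite_carrier: "finite (carrier G)" and order_power: "\<exists>k. order G = p ^ k"
    and surj: "h ` carrier G = carrier (columns p n)"
    and commute_iff: "\<And>x y. x \<in> carrier G \<Longrightarrow> y \<in> carrier G \<Longrightarrow>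
      x \<otimes> y = y \<otimes> x \<longleftrightarrow> commuting p n (h x) (h y)"
    and kernel_eq_derived: "kernel G (columns p n) h = derived G (carrier G)"
    and kernel_pow: "\<And>x. x \<in> kernel G (columns p n) h \<Longrightarrow> x [^] p = \<one>"
begin

abbreviation "K \<equiv> kernel G (columns p n) h"

lemma p_gt_1: "p > 1"
  using prime by (rule prime_gt_1_nat)

text \<open>Commutation in \<open>G\<close> is decided by the images under \<open>h\<close>, so
  centralizers are full preimages of commutants.\<close>

lemma centralizer_eq:
  assumes "A \<subseteq> carrier G"
  shows "centralizer G A = {x \<in> carrier G. h x \<in> commutant p n (h ` A)}"
proof -
  have "x \<otimes> a = a \<otimes> x \<longleftrightarrow> commuting p n (h a) (h x)" if "x \<in> carrier G" "a \<in> A" for x a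
    using commute_iff[of a x] that assms by auto
  moreover have "h x \<in> carrier (columns p n)" if "x \<in> carrier G" for x
    using that by (rule hom_closed)
  ultimately show ?thesis
    unfolding centralizer_def commutant_def by auto
qed

lemma center_eq: "group_center G = K"
  unfolding group_center_def centralizer_eq[OF subset_refl] surj commutant_carrier[OF p_gt_1]
  by (simp add: kernel_def)

lemma card_centralizer:
  assumes "A \<subseteq> carrier G"
  shows "card (centralizer G A) = card K * card (commutant p n (h ` A))"
  unfolding centralizer_eq[OF assms]
  by (rule card_vimage_surj[OF finite_carrier surj]) (unfold commutant_def, blast)

lemma finite_commutant: "finite (commutant p n U)"
proof (rule finite_subset)
  show "commutant p n U \<subseteq> carrier (columns p n)"
    unfolding commutant_def by blast
  show "finite (carrier (columns p n))"
    using p_gt_1 by (intro finite_columns) simp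
qed

lemma card_commutant_pos: "card (commutant p n U) > 0" if "U \<subseteq> carrier (columns p n)"
proof -
  have "\<one>\<^bsub>columns p n\<^esub> \<in> commutant p n (carrier (columns p n))"
    using commutant_carrier[OF p_gt_1] by blast
  then have "\<one>\<^bsub>columns p n\<^esub> \<in> commutant p n U"
    using that unfolding commutant_def by blast
  then show ?thesis
    using finite_commutant card_gt_0_iff by blast
qed

lemma card_kernel_pos: "card K > 0"
proof -
  have "finite K"
    using finite_carrier unfolding kernel_def by simp
  then show ?thesis
    using subgroup.one_closed[OF subgroup_kernel] card_gt_0_iff by blast
qed

text \<open>The centralizer has exactly \<open>card K\<close> times as many elements as the
  commutant, while \<open>A\<close> has at most \<open>card K\<close> times as many as its image,
  with equality just for full preimages. The rest is \<open>card_commutant_le\<close>.\<close>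

lemma cd_measure_le:
  assumes "subgroup A G"
  shows "cd_measure G A \<le> card K * card K * card (carrier (columns p n))"
    and "cd_measure G A = card K * card K * card (carrier (columns p n)) \<Longrightarrow>
      card (h ` A) * card (commutant p n (h ` A)) = card (carrier (columns p n)) \<and>
      A = {x \<in> carrier G. h x \<in> h ` A}"
proof -
  let ?B = "{x \<in> carrier G. h x \<in> h ` A}"
  let ?c = "card (commutant p n (h ` A))" and ?N = "card (carrier (columns p n))"
  have A: "A \<subseteq> carrier G" using assms by (rule subgroup.subset)
  have U: "subgroup (h ` A) (columns p n)" using assms by (rule subgroup_img_is_subgroup)
  have finB: "finite ?B" using finite_carrier by simp
  have AB: "A \<subseteq> ?B" using A by blast
  have cardB: "card ?B = card K * card (h ` A)"
    by (rule card_vimage_surj[OF finite_carrier surj subgroup.subset[OF U]])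
  have m: "cd_measure G A = card A * (card K * ?c)"
    unfolding cd_measure_def card_centralizer[OF A] ..
  have 1: "card A * (card K * ?c) \<le> (card K * card (h ` A)) * (card K * ?c)"
    using card_mono[OF finB AB] unfolding cardB by (rule mult_le_mono1)
  have 2: "card K * card K * (card (h ` A) * ?c) \<le> card K * card K * ?N"
    using card_commutant_le[OF p_gt_1 U] by (rule mult_le_mono2)
  have 3: "(card K * card (h ` A)) * (card K * ?c) = card K * card K * (card (h ` A) * ?c)"
    by (simp only: mult_ac)
  show "cd_measure G A \<le> card K * card K * ?N"
    using 1 2 unfolding m 3 by (rule order_trans)
  assume "cd_measure G A = card K * card K * ?N"
  \<comment> \<open>The bound is reached through two successive inequalities, so equality at the
    ends forces both; positive factors can then be cancelled.\<close>
  then have eq: "card K * card K * (card (h ` A) * ?c) = card K * card K * ?N"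
    "card A * (card K * ?c) = (card K * card (h ` A)) * (card K * ?c)"
    using 1 2 unfolding m 3 by linarith+
  have "card (h ` A) * ?c = ?N"
    using eq(1) card_kernel_pos by (simp only: nat_mult_eq_cancel1 nat_0_less_mult_iff simp_thms)
  moreover have "card A = card ?B"
    using eq(2) card_kernel_pos card_commutant_pos[OF subgroup.subset[OF U]] unfolding cardB by simp
  then have "A = ?B"
    using card_subset_eq[OF finB AB] by blast
  ultimately show "card (h ` A) * ?c = ?N \<and> A = ?B" by blast
qed

section \<open>The members of the Chermak-Delgado lattice\<close>

definition lift :: "(nat \<Rightarrow> int) set \<Rightarrow> 'a set" where
  "lift S = {x \<in> carrier G. h x \<in> column_power S}"

lemma subgroup_column_power:
  "subgroup S (elementary_abelian_power p n) \<Longrightarrow> subgroup (column_power S) (columns p n)"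
  by (simp add: PiE_subgroup_product_group)

lemma lift_subgroup:
  assumes S: "subgroup S (elementary_abelian_power p n)"
  shows "subgroup (lift S) G"
    and "cd_measure G (lift S) = card K * card K * card (carrier (columns p n))"
proof -
  note sub = subgroup.subset[OF subgroup_column_power[OF S]]
  show lift: "subgroup (lift S) G"
    unfolding lift_def by (rule subgroup_vimage[OF subgroup_column_power[OF S]])
  have "h ` lift S = column_power S"
    using sub unfolding lift_def surj[symmetric] by blast
  then have "cd_measure G (lift S) =
      card (lift S) * (card K * card (commutant p n (column_power S)))"
    unfolding cd_measure_def card_centralizer[OF subgroup.subset[OF lift]] by simp
  also have "card (lift S) = card K * card (column_power S)"
    unfolding lift_def by (rule card_vimage_surj[OF finite_carrier surj sub])
  finally show "cd_measure G (lift S) = card K * card K * card (carrier (columns p n))"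
    unfolding card_commutant_column_power[OF p_gt_1 S, symmetric] by (simp only: mult_ac)
qed

lemma max_cd_measure_eq: "max_cd_measure G = card K * card K * card (carrier (columns p n))"
  unfolding max_cd_measure_def
proof (rule Max_eqI)
  have "{cd_measure G H |H. subgroup H G} \<subseteq> cd_measure G ` Pow (carrier G)"
    using subgroup.subset by blast
  then show "finite {cd_measure G H |H. subgroup H G}"
    using finite_carrier by (meson finite_Pow_iff finite_imageI finite_subset)
  \<comment> \<open>The value is attained by \<open>G\<close> itself, the lift of the whole column
    space.\<close>
  show "card K * card K * card (carrier (columns p n)) \<in> {cd_measure G H |H. subgroup H G}"
    using lift_subgroup[OF group.subgroup_self] by (metis (mono_tags, lifting) group_elementary_abelian_power mem_Collect_eq)
qed (use cd_measure_le(1) in blast)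

text \<open>Equality in \<open>cd_measure_le\<close> makes a member the full preimage of its image
  and makes that image extremal in \<open>columns p n\<close>, hence a fourth power.\<close>

lemma CD_eq: "CD G = lift ` {S. subgroup S (elementary_abelian_power p n)}"
proof (intro equalityI subsetI)
  fix A assume "A \<in> CD G"
  then have A: "subgroup A G" "cd_measure G A = card K * card K * card (carrier (columns p n))"
    unfolding CD_def max_cd_measure_eq by auto
  obtain S where "subgroup S (elementary_abelian_power p n)" "h ` A = column_power S"
    using card_commutant_eq_imp_column_power[OF p_gt_1 subgroup_img_is_subgroup[OF A(1)]]
      cd_measure_le(2)[OF A] by blast
  then show "A \<in> lift ` {S. subgroup S (elementary_abelian_power p n)}"
    using cd_measure_le(2)[OF A] unfolding lift_def by auto
qed (use lift_subgroup in \<open>auto simp: CD_def max_cd_measure_eq\<close>)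

text \<open>Surjectivity of \<open>h\<close> provides an element of \<open>lift S\<close> over any
  vector of \<open>S\<close> placed in column 0; reading that column back recovers the
  vector.\<close>

lemma lift_subset_iff:
  assumes S: "subgroup S (elementary_abelian_power p n)"
  shows "lift S \<subseteq> lift T \<longleftrightarrow> S \<subseteq> T"
proof
  assume sub: "lift S \<subseteq> lift T"
  show "S \<subseteq> T"
  proof
    fix s assume s: "s \<in> S"
    have "column p n 0 s \<in> column_power S"
      using S s by (rule column_in_column_power)
    moreover obtain x where x: "x \<in> carrier G" "h x = column p n 0 s"
      using column_in_carrier[OF subgroup.mem_carrier[OF S s]] surj by (metis imageE)
    ultimately have "column p n 0 s \<in> column_power T"
      using sub unfolding lift_def by force
    then have "column p n 0 s 0 \<in> T"
      by (rule PiE_mem) simp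
    then show "s \<in> T" by (simp add: column_def)
  qed
qed (auto simp: lift_def PiE_iff)

lemma CD_lattice_isomorphic:
  "lattice_isomorphic (CD_lattice G) (subgroup_lattice (elementary_abelian_power p n))"
proof -
  let ?E = "elementary_abelian_power p n"
  have inj: "inj_on lift {S. subgroup S ?E}"
    using lift_subset_iff by (intro inj_onI equalityI) (simp_all flip: lift_subset_iff)
  \<comment> \<open>The inverse of \<open>lift\<close> is taken so that the subgroup lattice,
    already known to be a lattice, is the target.\<close>
  let ?f = "inv_into {S. subgroup S ?E} lift"
  have f: "bij_betw ?f (CD G) {S. subgroup S ?E}"
    unfolding CD_eq using inj by (intro bij_betw_inv_into) (simp add: bij_betw_def)
  have le: "?f A \<subseteq> ?f B \<longleftrightarrow> A \<subseteq> B" if AB: "A \<in> CD G" "B \<in> CD G" for A B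
  proof -
    obtain S T where S: "subgroup S ?E" "A = lift S" and T: "subgroup T ?E" "B = lift T"
      using AB unfolding CD_eq by blast
    have "?f A = S" "?f B = T"
      using S T by (simp_all add: inv_into_f_f[OF inj])
    then show ?thesis
      using lift_subset_iff[OF S(1)] S T by simp
  qed
  have "lattice (subgroup_lattice ?E)"
    unfolding subgroup_lattice_def
    by (rule complete_lattice_lattice[OF group.subgroups_complete_lattice]) simp
  moreover have "partial_order (CD_lattice G)"
    unfolding CD_lattice_def by unfold_locales auto
  ultimately show ?thesis
    by (rule order_iso_imp_lattice_isomorphic[where f = ?f])
      (use f le in \<open>simp_all add: CD_lattice_def subgroup_lattice_def\<close>)
qed

section \<open>Frattini subgroup and speciality\<close>

lemma entry_hom:
  assumes "i < 4" "k < n"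
  shows "(\<lambda>x. h x i k) \<in> hom G (integer_mod_group p)"
proof (rule homI)
  fix x y assume x: "x \<in> carrier G" and y: "y \<in> carrier G"
  have "h x i \<in> carrier (elementary_abelian_power p n)"
    using hom_closed[OF x] assms(1) by auto
  then show "h x i k \<in> carrier (integer_mod_group p)"
    using assms(2) by (auto simp: elementary_abelian_power_def)
  show "h (x \<otimes> y) i k = h x i k \<otimes>\<^bsub>integer_mod_group p\<^esub> h y i k"
    using assms x y by (simp add: elementary_abelian_power_def)
qed

text \<open>The matrix entries of \<open>h\<close> are homomorphisms to the integers modulo
  \<open>p\<close>; nonzero ones have maximal kernels, and these meet in \<open>K\<close>.
  Conversely, \<open>K\<close> is both center and derived subgroup, so it lies in every maximal
  subgroup.\<close>

lemma frattini_eq: "frattini_subgroup G = K"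
proof
  show "frattini_subgroup G \<subseteq> K"
  proof
    fix x assume x: "x \<in> frattini_subgroup G"
    then have xc: "x \<in> carrier G" unfolding frattini_subgroup_def by blast
    have 0: "h x i k = 0" if "i < 4" "k < n" for i k
    proof (rule ccontr)
      assume "h x i k \<noteq> 0"
      then have "maximal_subgroup (kernel G (integer_mod_group p) (\<lambda>g. h g i k)) G"
        using G.maximal_subgroup_kernel[OF prime entry_hom[OF that] xc] by blast
      then have "x \<in> kernel G (integer_mod_group p) (\<lambda>g. h g i k)"
        using x unfolding frattini_subgroup_def by blast
      then show False using \<open>h x i k \<noteq> 0\<close> by (simp add: kernel_def)
    qed
    have hx: "h x \<in> carrier (columns p n)" using xc by (rule hom_closed)
    have "h x i = \<one>\<^bsub>elementary_abelian_power p n\<^esub>" if "i < 4" for i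
    proof -
      have "h x i \<in> carrier (elementary_abelian_power p n)" using hx that by auto
      then have "h x i k = undefined" if "\<not> k < n" for k
        using that PiE_arb[of "h x i" "{..<n}"] by (simp add: elementary_abelian_power_def)
      then show ?thesis
        using 0[OF that] by (intro ext) (simp add: elementary_abelian_power_def)
    qed
    moreover have "h x i = undefined" if "\<not> i < 4" for i
      using hx that PiE_arb[of "h x" "{..<4}"] by simp
    ultimately have "h x = \<one>\<^bsub>columns p n\<^esub>"
      by (intro ext) simp
    then show "x \<in> K" using xc by (simp add: kernel_def)
  qed
  show "K \<subseteq> frattini_subgroup G"
    using G.center_inter_derived_subset_frattini kernel_eq_derived center_eq by simp
qed

text \<open>A commutative \<open>G\<close> would equal its center \<open>K\<close>, forcing
  \<open>columns p n\<close> to be trivial; as \<open>n\<close> is positive, a unit vector in column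
  0 contradicts this.\<close>

lemma not_comm_group: "\<not> comm_group G"
proof
  assume "comm_group G"
  then have "carrier G \<subseteq> group_center G"
    by (auto simp: group_center_def centralizer_def comm_groupE(4))
  then have triv: "h x = \<one>\<^bsub>columns p n\<^esub>" if "x \<in> carrier G" for x
    using that unfolding center_eq by (auto simp: kernel_def)
  have "column p n 0 (single n 0 1) \<in> carrier (columns p n)"
    using p_gt_1 by (intro column_in_carrier single_in_carrier) auto
  then have "column p n 0 (single n 0 1) = \<one>\<^bsub>columns p n\<^esub>"
    using triv surj by (metis imageE)
  then have "column p n 0 (single n 0 1) 0 0 = \<one>\<^bsub>columns p n\<^esub> 0 0" by simp
  then show False
    using n_pos by (simp add: column_def single_def elementary_abelian_power_def)
qed

lemma special: "special_p_group p G"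
proof -
  have comm: "comm_group (G\<lparr>carrier := group_center G\<rparr>)"
  proof (rule group.group_comm_groupI)
    show "group (G\<lparr>carrier := group_center G\<rparr>)"
      using G.subgroup_group_center by (rule G.subgroup_imp_group)
  qed (use G.center_commute subgroup.mem_carrier[OF G.subgroup_group_center] in auto)
  have "x [^]\<^bsub>G\<lparr>carrier := group_center G\<rparr>\<^esub> p = \<one>" if "x \<in> group_center G" for x
    using kernel_pow[of x] that center_eq G.nat_pow_consistent[of x p "group_center G"] by simp
  then have "elementary_abelian p (G\<lparr>carrier := group_center G\<rparr>)"
    using prime comm unfolding elementary_abelian_def by simp
  then show ?thesis
    unfolding special_p_group_def finite_p_group_def
    using prime finite_carrier order_power not_comm_group frattini_eq center_eq kernel_eq_derived G.is_group
    by simp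
qed

end

section \<open>Construction of the extension\<close>

definition central_extension ::
    "('a, 'c) monoid_scheme \<Rightarrow> ('b, 'd) monoid_scheme \<Rightarrow> ('a \<Rightarrow> 'a \<Rightarrow> 'b) \<Rightarrow> ('a \<times> 'b) monoid" where
  "central_extension V W \<beta> = \<lparr>carrier = carrier V \<times> carrier W,
     monoid.mult = (\<lambda>(v, w) (v', w'). (v \<otimes>\<^bsub>V\<^esub> v', w \<otimes>\<^bsub>W\<^esub> w' \<otimes>\<^bsub>W\<^esub> \<beta> v v')),
     one = (\<one>\<^bsub>V\<^esub>, \<one>\<^bsub>W\<^esub>)\<rparr>"

locale bilinear_cocycle = V: comm_group V + W: comm_group W
  for V :: "('a, 'c) monoid_scheme" and W :: "('b, 'd) monoid_scheme" +
  fixes \<beta> :: "'a \<Rightarrow> 'a \<Rightarrow> 'b"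
  assumes closed [simp]: "\<And>u v. u \<in> carrier V \<Longrightarrow> v \<in> carrier V \<Longrightarrow> \<beta> u v \<in> carrier W"
    and mult_left: "\<And>u u' v. u \<in> carrier V \<Longrightarrow> u' \<in> carrier V \<Longrightarrow> v \<in> carrier V \<Longrightarrow>
      \<beta> (u \<otimes>\<^bsub>V\<^esub> u') v = \<beta> u v \<otimes>\<^bsub>W\<^esub> \<beta> u' v"
    and mult_right: "\<And>u v v'. u \<in> carrier V \<Longrightarrow> v \<in> carrier V \<Longrightarrow> v' \<in> carrier V \<Longrightarrow>
      \<beta> u (v \<otimes>\<^bsub>V\<^esub> v') = \<beta> u v \<otimes>\<^bsub>W\<^esub> \<beta> u v'"
begin

abbreviation "E \<equiv> central_extension V W \<beta>"

lemma carrier_E: "carrier E = carrier V \<times> carrier W"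
  and mult_E: "(v, w) \<otimes>\<^bsub>E\<^esub> (v', w') = (v \<otimes>\<^bsub>V\<^esub> v', w \<otimes>\<^bsub>W\<^esub> w' \<otimes>\<^bsub>W\<^esub> \<beta> v v')"
  and one_E: "\<one>\<^bsub>E\<^esub> = (\<one>\<^bsub>V\<^esub>, \<one>\<^bsub>W\<^esub>)"
  by (simp_all add: central_extension_def)

lemma one_left: "v \<in> carrier V \<Longrightarrow> \<beta> \<one>\<^bsub>V\<^esub> v = \<one>\<^bsub>W\<^esub>"
  using mult_left[of "\<one>\<^bsub>V\<^esub>" "\<one>\<^bsub>V\<^esub>" v] by simp

lemma group_E: "group E"
proof (rule groupI)
  fix x y z assume "x \<in> carrier E" "y \<in> carrier E" "z \<in> carrier E"
  then obtain u a v b t c where xyz: "x = (u, a)" "y = (v, b)" "z = (t, c)"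
    and c: "u \<in> carrier V" "v \<in> carrier V" "t \<in> carrier V"
      "a \<in> carrier W" "b \<in> carrier W" "c \<in> carrier W"
    by (auto simp: carrier_E)
  show "x \<otimes>\<^bsub>E\<^esub> y \<in> carrier E"
    using c by (simp add: xyz carrier_E mult_E)
  \<comment> \<open>By bilinearity both sides collect the same three terms
    \<open>\<beta> u v\<close>, \<open>\<beta> u t\<close> and \<open>\<beta> v t\<close>.\<close>
  show "x \<otimes>\<^bsub>E\<^esub> y \<otimes>\<^bsub>E\<^esub> z = x \<otimes>\<^bsub>E\<^esub> (y \<otimes>\<^bsub>E\<^esub> z)"
    using c by (simp add: xyz mult_E V.m_assoc mult_left mult_right W.m_ac)
next
  show "\<one>\<^bsub>E\<^esub> \<in> carrier E"
    by (simp add: one_E carrier_E)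
next
  fix x assume "x \<in> carrier E"
  then obtain u a where x: "x = (u, a)" and c: "u \<in> carrier V" "a \<in> carrier W"
    by (auto simp: carrier_E)
  show "\<one>\<^bsub>E\<^esub> \<otimes>\<^bsub>E\<^esub> x = x"
    using c by (simp add: x one_E mult_E one_left)
  \<comment> \<open>The second component of the left inverse has to absorb the cocycle value at
    \<open>inv u\<close> and \<open>u\<close> as well as \<open>a\<close>.\<close>
  have inv: "inv\<^bsub>V\<^esub> u \<in> carrier V" "inv\<^bsub>W\<^esub> (a \<otimes>\<^bsub>W\<^esub> \<beta> (inv\<^bsub>V\<^esub> u) u) \<in> carrier W"
    using c by simp_all
  have "inv\<^bsub>W\<^esub> (a \<otimes>\<^bsub>W\<^esub> \<beta> (inv\<^bsub>V\<^esub> u) u) \<otimes>\<^bsub>W\<^esub> a \<otimes>\<^bsub>W\<^esub> \<beta> (inv\<^bsub>V\<^esub> u) u = \<one>\<^bsub>W\<^esub>"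
    using c W.l_inv[of "a \<otimes>\<^bsub>W\<^esub> \<beta> (inv\<^bsub>V\<^esub> u) u"] by (simp add: W.m_assoc)
  then have "(inv\<^bsub>V\<^esub> u, inv\<^bsub>W\<^esub> (a \<otimes>\<^bsub>W\<^esub> \<beta> (inv\<^bsub>V\<^esub> u) u)) \<otimes>\<^bsub>E\<^esub> x = \<one>\<^bsub>E\<^esub>"
    using c by (simp only: x one_E mult_E V.l_inv)
  moreover have "(inv\<^bsub>V\<^esub> u, inv\<^bsub>W\<^esub> (a \<otimes>\<^bsub>W\<^esub> \<beta> (inv\<^bsub>V\<^esub> u) u)) \<in> carrier E"
    using inv unfolding carrier_E by blast
  ultimately show "\<exists>y\<in>carrier E. y \<otimes>\<^bsub>E\<^esub> x = \<one>\<^bsub>E\<^esub>"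
    by blast
qed

sublocale E: group E
  by (rule group_E)

lemma fst_hom: "fst \<in> hom E V"
  by (rule homI) (auto simp: carrier_E mult_E)

sublocale fst: group_hom E V fst
  by (intro group_hom.intro group_hom_axioms.intro fst_hom E.is_group V.is_group)

lemma fst_image: "fst ` carrier E = carrier V"
  using W.one_closed unfolding carrier_E by (force simp: image_iff)

lemma kernel_fst: "kernel E V fst = {\<one>\<^bsub>V\<^esub>} \<times> carrier W"
  unfolding kernel_def carrier_E by auto

lemma commute_iff:
  assumes "x \<in> carrier E" "y \<in> carrier E"
  shows "x \<otimes>\<^bsub>E\<^esub> y = y \<otimes>\<^bsub>E\<^esub> x \<longleftrightarrow> \<beta> (fst x) (fst y) = \<beta> (fst y) (fst x)"
proof -
  obtain u a v b where xy: "x = (u, a)" "y = (v, b)"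
    and c: "u \<in> carrier V" "v \<in> carrier V" "a \<in> carrier W" "b \<in> carrier W"
    using assms by (auto simp: carrier_E)
  have "a \<otimes>\<^bsub>W\<^esub> b \<otimes>\<^bsub>W\<^esub> \<beta> u v = a \<otimes>\<^bsub>W\<^esub> b \<otimes>\<^bsub>W\<^esub> \<beta> v u \<longleftrightarrow> \<beta> u v = \<beta> v u"
    using c by simp
  then show ?thesis
    using c by (simp add: xy mult_E V.m_comm[of v u] W.m_comm[of b a])
qed

lemma central_mult:
  "w \<in> carrier W \<Longrightarrow> w' \<in> carrier W \<Longrightarrow>
    (\<one>\<^bsub>V\<^esub>, w) \<otimes>\<^bsub>E\<^esub> (\<one>\<^bsub>V\<^esub>, w') = (\<one>\<^bsub>V\<^esub>, w \<otimes>\<^bsub>W\<^esub> w')"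
  by (simp add: mult_E one_left)

lemma central_pow:
  "w \<in> carrier W \<Longrightarrow> (\<one>\<^bsub>V\<^esub>, w) [^]\<^bsub>E\<^esub> (m :: nat) = (\<one>\<^bsub>V\<^esub>, w [^]\<^bsub>W\<^esub> m)"
  by (induction m) (simp_all add: one_E central_mult)

lemma derived_subset: "derived E (carrier E) \<subseteq> kernel E V fst"
proof -
  have "fst ` derived E (carrier E) = {\<one>\<^bsub>V\<^esub>}"
    using fst.derived_img[OF subset_refl] V.derived_eq_singleton[OF subset_refl] fst_image by simp
  then show ?thesis
    using E.derived_in_carrier[OF subset_refl] unfolding kernel_def by blast
qed

text \<open>The commutator of the lifts \<open>(u, \<one>)\<close> and \<open>(v, \<one>)\<close>
  has second component the quotient of \<open>\<beta> u v\<close> by \<open>\<beta> v u\<close>;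
  \<open>eq\<close> expresses this quotient without an inverse.\<close>

lemma commutator_in_derived:
  assumes u: "u \<in> carrier V" and v: "v \<in> carrier V" and w: "w \<in> carrier W"
    and eq: "\<beta> u v = w \<otimes>\<^bsub>W\<^esub> \<beta> v u"
  shows "(\<one>\<^bsub>V\<^esub>, w) \<in> derived E (carrier E)"
proof -
  let ?x = "(u, \<one>\<^bsub>W\<^esub>)" and ?y = "(v, \<one>\<^bsub>W\<^esub>)"
  have xy: "?x \<in> carrier E" "?y \<in> carrier E" "(\<one>\<^bsub>V\<^esub>, w) \<in> carrier E"
    using u v w by (simp_all add: carrier_E)
  have "?x \<otimes>\<^bsub>E\<^esub> ?y = (\<one>\<^bsub>V\<^esub>, w) \<otimes>\<^bsub>E\<^esub> (?y \<otimes>\<^bsub>E\<^esub> ?x)"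
    using u v w eq by (simp add: mult_E one_left V.m_comm[of v u])
  then have "?x \<otimes>\<^bsub>E\<^esub> ?y \<otimes>\<^bsub>E\<^esub> inv\<^bsub>E\<^esub> ?x \<otimes>\<^bsub>E\<^esub> inv\<^bsub>E\<^esub> ?y = (\<one>\<^bsub>V\<^esub>, w)"
    by (rule E.commutator_eqI[OF xy(3,1,2)])
  then have "(\<one>\<^bsub>V\<^esub>, w) \<in> {?x \<otimes>\<^bsub>E\<^esub> ?y \<otimes>\<^bsub>E\<^esub> inv\<^bsub>E\<^esub> ?x \<otimes>\<^bsub>E\<^esub> inv\<^bsub>E\<^esub> ?y}"
    by (simp only: singleton_iff)
  then have "(\<one>\<^bsub>V\<^esub>, w) \<in> derived_set E (carrier E)"
    by (rule UN_I[OF xy(1) UN_I[OF xy(2)]])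
  then show ?thesis
    unfolding derived_def by (rule generate.incl)
qed

end

section \<open>The explicit cocycle on four columns\<close>

definition upper_pairs :: "(nat \<times> nat) set" where
  "upper_pairs = {(i, j). i < j \<and> j < 4}"

abbreviation center_power :: "nat \<Rightarrow> (nat \<times> nat \<Rightarrow> int) monoid" where
  "center_power p \<equiv> product_group upper_pairs (\<lambda>_. integer_mod_group p)"

text \<open>Only the products of \<open>u i\<close> with \<open>v j\<close> for \<open>i < j\<close>
  enter, so antisymmetrizing yields the commutator form. Taking that alternating form itself as
  cocycle would double it in the commutator and lose everything for \<open>p = 2\<close>.\<close>

definition cocycle :: "nat \<Rightarrow> nat \<Rightarrow> (nat \<Rightarrow> nat \<Rightarrow> int) \<Rightarrow> (nat \<Rightarrow> nat \<Rightarrow> int) \<Rightarrow> nat \<times> nat \<Rightarrow> int" where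
  "cocycle p n u v = (\<lambda>(i, j)\<in>upper_pairs. dot n (u i) (v j) mod int p)"

lemma finite_upper_pairs: "finite upper_pairs"
  by (rule finite_subset[of _ "{..<4} \<times> {..<4}"]) (auto simp: upper_pairs_def)

lemma comm_group_product_group:
  assumes "\<And>i. i \<in> I \<Longrightarrow> comm_group (G i)"
  shows "comm_group (product_group I G)"
proof (rule group.group_comm_groupI)
  show "group (product_group I G)"
    using assms by (intro product_group) (simp add: comm_group.axioms(2))
  fix x y assume "x \<in> carrier (product_group I G)" "y \<in> carrier (product_group I G)"
  then have "x i \<otimes>\<^bsub>G i\<^esub> y i = y i \<otimes>\<^bsub>G i\<^esub> x i" if "i \<in> I" for i
    using comm_groupE(4)[OF assms[OF that]] that by (auto simp: PiE_iff)
  then show "x \<otimes>\<^bsub>product_group I G\<^esub> y = y \<otimes>\<^bsub>product_group I G\<^esub> x"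
    by (auto intro: restrict_ext)
qed

lemma carrier_center_power:
  "p > 0 \<Longrightarrow> carrier (center_power p) = (\<Pi>\<^sub>E x\<in>upper_pairs. {0..<int p})"
  by (simp add: carrier_integer_mod_group)

lemma bilinear_cocycle_cocycle:
  assumes p: "p > 0"
  shows "bilinear_cocycle (columns p n) (center_power p) (cocycle p n)"
proof (intro bilinear_cocycle.intro bilinear_cocycle_axioms.intro)
  show "comm_group (columns p n)"
    unfolding elementary_abelian_power_def
    by (intro comm_group_product_group abelian_integer_mod_group)
  show "comm_group (center_power p)"
    by (intro comm_group_product_group abelian_integer_mod_group)
  fix u v t
  show "cocycle p n u v \<in> carrier (center_power p)"
    unfolding carrier_center_power[OF p] cocycle_def using p by (auto split: prod.splits)
  have less: "i < 4" "j < 4" if "(i, j) \<in> upper_pairs" for i j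
    using that by (auto simp: upper_pairs_def)
  show "cocycle p n (u \<otimes>\<^bsub>columns p n\<^esub> v) t = cocycle p n u t \<otimes>\<^bsub>center_power p\<^esub> cocycle p n v t"
  proof (rule ext, clarify)
    fix i j
    show "cocycle p n (u \<otimes>\<^bsub>columns p n\<^esub> v) t (i, j) =
      (cocycle p n u t \<otimes>\<^bsub>center_power p\<^esub> cocycle p n v t) (i, j)"
      using less[of i j] dot_mult_left[of n p "u i" "v i" "t j"]
      by (cases "(i, j) \<in> upper_pairs") (simp_all add: cocycle_def cong_def mod_add_eq)
  qed
  show "cocycle p n u (v \<otimes>\<^bsub>columns p n\<^esub> t) = cocycle p n u v \<otimes>\<^bsub>center_power p\<^esub> cocycle p n u t"
  proof (rule ext, clarify)
    fix i j
    show "cocycle p n u (v \<otimes>\<^bsub>columns p n\<^esub> t) (i, j) =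
      (cocycle p n u v \<otimes>\<^bsub>center_power p\<^esub> cocycle p n u t) (i, j)"
      using less[of i j] dot_mult_right[of n "u i" p "v j" "t j"]
      by (cases "(i, j) \<in> upper_pairs") (simp_all add: cocycle_def cong_def mod_add_eq)
  qed
qed

text \<open>The pairs \<open>i < j\<close> suffice: equal indices give a trivial congruence, and
  interchanging \<open>i\<close> and \<open>j\<close> reverses it.\<close>

lemma cocycle_sym_iff: "cocycle p n u v = cocycle p n v u \<longleftrightarrow> commuting p n u v"
proof
  assume eq: "cocycle p n u v = cocycle p n v u"
  have less: "[dot n (u i) (v j) = dot n (u j) (v i)] (mod int p)" if "i < j" "j < 4" for i j
  proof -
    have "cocycle p n u v (i, j) = cocycle p n v u (i, j)" using eq by simp
    then show ?thesis
      using that by (simp add: cocycle_def upper_pairs_def cong_def dot_commute[of n "v i" "u j"])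
  qed
  show "commuting p n u v"
    unfolding commuting_def
  proof (intro allI impI)
    fix i j :: nat assume "i < 4" "j < 4"
    then show "[dot n (u i) (v j) = dot n (u j) (v i)] (mod int p)"
      using less[of i j] less[of j i, THEN cong_sym] by (cases i j rule: linorder_cases) simp_all
  qed
next
  assume comm: "commuting p n u v"
  have "dot n (u i) (v j) mod int p = dot n (v i) (u j) mod int p" if "(i, j) \<in> upper_pairs" for i j
  proof -
    have "i < 4" "j < 4" using that by (auto simp: upper_pairs_def)
    then have "[dot n (u i) (v j) = dot n (u j) (v i)] (mod int p)"
      using comm unfolding commuting_def by blast
    then show ?thesis by (simp add: cong_def dot_commute[of n "v i" "u j"])
  qed
  then show "cocycle p n u v = cocycle p n v u"
    unfolding cocycle_def by (intro restrict_ext) auto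
qed

locale column_extension =
  fixes p n :: nat
  assumes prime: "Factorial_Ring.prime p" and n_pos: "n > 0"
begin

lemma p_gt_1: "p > 1"
  using prime by (rule prime_gt_1_nat)

sublocale bilinear_cocycle "columns p n" "center_power p" "cocycle p n"
  using p_gt_1 by (intro bilinear_cocycle_cocycle) simp

text \<open>Multiples of one unit vector are placed in columns \<open>i\<close> and
  \<open>j\<close>. Since \<open>i < j\<close>, the cocycle sees their product only in the order
  \<open>?u\<close>, \<open>?v\<close>, and the reversed cocycle vanishes.\<close>

lemma single_pair_in_derived:
  assumes ij: "(i, j) \<in> upper_pairs" and c: "c \<in> {0..<int p}"
  shows "(\<one>\<^bsub>columns p n\<^esub>, \<lambda>x\<in>upper_pairs. if x = (i, j) then c else 0) \<in> derived E (carrier E)"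
proof -
  let ?u = "column p n i (single n 0 1)" and ?v = "column p n j (single n 0 c)"
  let ?w = "\<lambda>x\<in>upper_pairs. if x = (i, j) then c else 0"
  have ltij: "i < j" "i < 4" "j < 4" using ij by (auto simp: upper_pairs_def)
  have "dot n (?u i') (?v j') mod int p = (if (i', j') = (i, j) then c else 0)"
    if "(i', j') \<in> upper_pairs" for i' j'
    using that c n_pos ltij by (auto simp: upper_pairs_def column_def dot_single) (auto simp: single_def)
  then have uv: "cocycle p n ?u ?v = ?w"
    unfolding cocycle_def by (intro restrict_ext) auto
  have "dot n (?v i') (?u j') mod int p = 0" if "(i', j') \<in> upper_pairs" for i' j'
    using that ltij by (auto simp: upper_pairs_def column_def)
  then have vu: "cocycle p n ?v ?u = \<one>\<^bsub>center_power p\<^esub>"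
    unfolding cocycle_def one_product_group by (intro restrict_ext) auto
  have w: "?w \<in> carrier (center_power p)"
    using c p_gt_1 by (auto simp: carrier_integer_mod_group)
  show ?thesis
  proof (rule commutator_in_derived[of ?u ?v, OF _ _ w])
    show "?u \<in> carrier (columns p n)" "?v \<in> carrier (columns p n)"
      using c p_gt_1 by (intro column_in_carrier single_in_carrier; simp)+
    show "cocycle p n ?u ?v = ?w \<otimes>\<^bsub>center_power p\<^esub> cocycle p n ?v ?u"
      unfolding uv vu by (rule W.r_one[OF w, symmetric])
  qed
qed

text \<open>Every kernel element is a product of elements supported on a single pair, each of which
  is a commutator.\<close>

lemma kernel_eq_derived: "kernel E (columns p n) fst = derived E (carrier E)"
proof
  show "kernel E (columns p n) fst \<subseteq> derived E (carrier E)"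
  proof
    fix z assume "z \<in> kernel E (columns p n) fst"
    then obtain w where w: "w \<in> carrier (center_power p)" "z = (\<one>\<^bsub>columns p n\<^esub>, w)"
      unfolding kernel_fst by blast
    \<comment> \<open>\<open>?r A\<close> keeps the coordinates of \<open>w\<close> in
      \<open>A\<close>; induction on \<open>A\<close> adds one commutator at a time and ends with
      \<open>w\<close> itself.\<close>
    let ?r = "\<lambda>A. \<lambda>x\<in>upper_pairs. if x \<in> A then w x else 0"
    have wx: "w x \<in> {0..<int p}" if "x \<in> upper_pairs" for x
      using w(1) that p_gt_1 by (auto simp: carrier_integer_mod_group)
    have der: "subgroup (derived E (carrier E)) E"
      by (rule E.derived_is_subgroup) simp
    have "(\<one>\<^bsub>columns p n\<^esub>, ?r A) \<in> derived E (carrier E)" if "finite A" "A \<subseteq> upper_pairs" for A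
      using that
    proof (induction A rule: finite_induct)
      case empty
      have "?r {} = \<one>\<^bsub>center_power p\<^esub>"
        by simp
      then show ?case
        using subgroup.one_closed[OF der] unfolding one_E by (simp only:)
    next
      case (insert x A)
      obtain i j where x: "x = (i, j)" by (cases x)
      let ?s = "\<lambda>y\<in>upper_pairs. if y = (i, j) then w x else 0"
      have "(\<one>\<^bsub>columns p n\<^esub>, ?s) \<in> derived E (carrier E)"
        using insert.prems wx by (intro single_pair_in_derived) (auto simp: x)
      moreover have "(\<one>\<^bsub>columns p n\<^esub>, ?r A) \<in> derived E (carrier E)"
        using insert by blast
      ultimately have "(\<one>\<^bsub>columns p n\<^esub>, ?s) \<otimes>\<^bsub>E\<^esub> (\<one>\<^bsub>columns p n\<^esub>, ?r A) \<in> derived E (carrier E)"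
        by (rule subgroup.m_closed[OF der])
      moreover have "?s \<in> carrier (center_power p)" "?r A \<in> carrier (center_power p)"
        using wx insert.prems p_gt_1 by (auto simp: carrier_integer_mod_group)
      moreover have "?s \<otimes>\<^bsub>center_power p\<^esub> ?r A = ?r (insert x A)"
        unfolding mult_product_group
        using wx insert.hyps by (intro restrict_ext) (auto simp: x)
      ultimately show ?case
        by (simp only: central_mult)
    qed
    from this[OF finite_upper_pairs subset_refl]
    have "(\<one>\<^bsub>columns p n\<^esub>, ?r upper_pairs) \<in> derived E (carrier E)" .
    moreover have "?r upper_pairs = w"
      using PiE_restrict[of w upper_pairs] w(1) by (simp cong: restrict_cong)
    ultimately show "z \<in> derived E (carrier E)"
      using w(2) by simp
  qed
qed (rule derived_subset)

lemma central_pow_p: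
  assumes "w \<in> carrier (center_power p)"
  shows "w [^]\<^bsub>center_power p\<^esub> p = \<one>\<^bsub>center_power p\<^esub>"
proof -
  have "w [^]\<^bsub>center_power p\<^esub> (m :: nat) = (\<lambda>x\<in>upper_pairs. (int m * w x) mod int p)" for m
    by (induction m) (auto simp: distrib_right add.commute mod_add_right_eq intro!: restrict_ext)
  then show ?thesis by (auto intro: restrict_ext)
qed

lemma commuting_extension_E: "commuting_extension E p n fst"
proof (intro commuting_extension.intro commuting_extension_axioms.intro)
  show "group_hom E (columns p n) fst" by (rule fst.group_hom_axioms)
  show "Factorial_Ring.prime p" "n > 0" by (rule prime n_pos)+
  have fin: "finite (carrier (center_power p))"
    using p_gt_1 by (simp add: carrier_integer_mod_group finite_PiE finite_upper_pairs)
  then show "finite (carrier E)"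
    unfolding carrier_E using finite_columns[of p n] p_gt_1 by (intro finite_cartesian_product) auto
  have "card (carrier (center_power p)) = p ^ card upper_pairs"
    using p_gt_1 finite_upper_pairs by (simp add: carrier_integer_mod_group card_PiE)
  moreover have "card (carrier (columns p n)) = (p ^ n) ^ 4"
    using order_elementary_abelian_power[OF prime, of n] by (simp add: order_def card_PiE)
  ultimately have "order E = p ^ (n * 4 + card upper_pairs)"
    unfolding order_def carrier_E card_cartesian_product by (simp only: power_add power_mult)
  then show "\<exists>k. order E = p ^ k" by blast
  show "fst ` carrier E = carrier (columns p n)" by (rule fst_image)
  show "x \<otimes>\<^bsub>E\<^esub> y = y \<otimes>\<^bsub>E\<^esub> x \<longleftrightarrow> commuting p n (fst x) (fst y)"
    if "x \<in> carrier E" "y \<in> carrier E" for x y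
    unfolding commute_iff[OF that] cocycle_sym_iff ..
  show "kernel E (columns p n) fst = derived E (carrier E)" by (rule kernel_eq_derived)
  show "x [^]\<^bsub>E\<^esub> p = \<one>\<^bsub>E\<^esub>" if "x \<in> kernel E (columns p n) fst" for x
    using that central_pow central_pow_p unfolding kernel_fst one_E by (auto simp del: carrier_product_group one_product_group)
qed

end

section \<open>Transport to a group of natural numbers\<close>

lemma (in commuting_extension) commuting_extension_iso:
  assumes H: "group H" and iso: "\<psi> \<in> iso H G"
  shows "commuting_extension H p n (h \<circ> \<psi>)"
proof -
  have hom: "\<psi> \<in> hom H G" and bij: "bij_betw \<psi> (carrier H) (carrier G)"
    using iso by (simp_all add: iso_def)
  interpret psi: group_hom H G \<psi>
    by (intro group_hom.intro group_hom_axioms.intro hom H G.is_group)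
  have inj: "inj_on \<psi> (carrier H)" and img: "\<psi> ` carrier H = carrier G"
    using bij by (simp_all add: bij_betw_def)
  have inj_eq: "\<psi> x = \<psi> y \<longleftrightarrow> x = y" if "x \<in> carrier H" "y \<in> carrier H" for x y
    using inj_on_eq_iff[OF inj that] .
  have comp: "h \<circ> \<psi> \<in> hom H (columns p n)"
    by (rule Group.hom_compose[OF hom homh])
  have der: "\<psi> ` derived H (carrier H) = derived G (carrier G)"
    using psi.derived_img[OF subset_refl] img by simp
  have ker: "x \<in> kernel H (columns p n) (h \<circ> \<psi>) \<longleftrightarrow> x \<in> carrier H \<and> \<psi> x \<in> K" for x
    unfolding kernel_def by auto
  show ?thesis
  proof (intro commuting_extension.intro commuting_extension_axioms.intro)
    show "group_hom H (columns p n) (h \<circ> \<psi>)"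
      by (intro group_hom.intro group_hom_axioms.intro comp H group_columns)
    show "Factorial_Ring.prime p" "n > 0" by (rule prime n_pos)+
    show "finite (carrier H)"
      using bij finite_carrier bij_betw_finite by blast
    show "\<exists>k. order H = p ^ k"
      using order_power bij_betw_same_card[OF bij] by (simp add: order_def)
    show "(h \<circ> \<psi>) ` carrier H = carrier (columns p n)"
      unfolding image_comp[symmetric] img surj ..
    show "x \<otimes>\<^bsub>H\<^esub> y = y \<otimes>\<^bsub>H\<^esub> x \<longleftrightarrow> commuting p n ((h \<circ> \<psi>) x) ((h \<circ> \<psi>) y)"
      if xy: "x \<in> carrier H" "y \<in> carrier H" for x y
    proof -
      have "x \<otimes>\<^bsub>H\<^esub> y = y \<otimes>\<^bsub>H\<^esub> x \<longleftrightarrow> \<psi> x \<otimes> \<psi> y = \<psi> y \<otimes> \<psi> x"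
        using inj_eq[of "x \<otimes>\<^bsub>H\<^esub> y" "y \<otimes>\<^bsub>H\<^esub> x"] xy by simp
      then show ?thesis
        using commute_iff[OF psi.hom_closed psi.hom_closed] xy by simp
    qed
    have sub: "derived H (carrier H) \<subseteq> carrier H"
      by (rule psi.G.derived_in_carrier[OF subset_refl])
    have "\<psi> x \<in> K \<longleftrightarrow> x \<in> derived H (carrier H)" if "x \<in> carrier H" for x
      unfolding kernel_eq_derived der[symmetric] by (rule inj_on_image_mem_iff[OF inj that sub])
    then show "kernel H (columns p n) (h \<circ> \<psi>) = derived H (carrier H)"
      using sub ker by blast
    show "x [^]\<^bsub>H\<^esub> p = \<one>\<^bsub>H\<^esub>" if "x \<in> kernel H (columns p n) (h \<circ> \<psi>)" for x
    proof -
      have x: "x \<in> carrier H" "\<psi> x \<in> K" using that ker by auto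
      then have "\<psi> (x [^]\<^bsub>H\<^esub> p) = \<psi> \<one>\<^bsub>H\<^esub>"
        using kernel_pow psi.hom_nat_pow by simp
      then show ?thesis
        using inj_eq[OF psi.G.nat_pow_closed[OF x(1)] psi.G.one_closed] by simp
    qed
  qed
qed

text \<open>The theorem asks for a carrier of natural numbers, so the structure is transported along
  an injection of the finite carrier.\<close>

lemma (in group) finite_iso_nat_monoid:
  assumes "finite (carrier G)"
  shows "\<exists>(H :: nat monoid) \<psi>. group H \<and> \<psi> \<in> iso H G"
proof -
  obtain f :: "'a \<Rightarrow> nat" where f: "inj_on f (carrier G)"
    using finite_imp_inj_to_nat_seg[OF assms] by auto
  let ?g = "inv_into (carrier G) f"
  define H :: "nat monoid" where
    "H = \<lparr>carrier = f ` carrier G, monoid.mult = (\<lambda>x y. f (?g x \<otimes> ?g y)), one = f \<one>\<rparr>"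
  have "f \<in> iso G H"
    using f by (auto simp: iso_def hom_def bij_betw_def H_def)
  moreover from this have "group H"
    using iso_imp_img_group[of f H] by (simp add: H_def)
  ultimately show ?thesis
    using iso_set_sym by blast
qed

theorem theoremB:
  fixes n p :: nat
  assumes "n > 0" and "Factorial_Ring.prime p"
  shows "\<exists>G :: nat monoid. special_p_group p G \<and>
           lattice_isomorphic (CD_lattice G) (subgroup_lattice (elementary_abelian_power p n))"
proof -
  interpret column_extension p n
    using assms by unfold_locales
  interpret X: commuting_extension E p n fst
    by (rule commuting_extension_E)
  obtain G :: "nat monoid" and \<psi> where "group G" "\<psi> \<in> iso G E"
    using E.finite_iso_nat_monoid[OF X.finite_carrier] by blast
  then interpret G: commuting_extension G p n "fst \<circ> \<psi>"
    by (rule X.commuting_extension_iso)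
  show ?thesis
    using G.special G.CD_lattice_isomorphic by blast
qed

end
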